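(* Let $A$ be a Banach $*$-algebra, let $\alpha\ge2$ and put $\beta:=\alpha+1$. The following statements are equivalent: (i) $A$ is Hermitian; (ii) for each $a\in A$ one has $\mathrm{sp}(a^*a)\subset[-\lambda,\lambda]$, where $\lambda:=\max\big((\mathrm{sp}(a^*a)\cap[0,\infty))\cup\{0\}\big)$; (iii) for all $a\in A$ with $r_\sigma(a)\le1$ one has $r_\sigma(c)\le1$, where $c:=\alpha^{-1}(\beta a-aa^*a)$; (iv) for every $a\in A$, $\mathrm{sp}(a^*a)$ contains no real number $\lambda<0$; (v) $e+a^*a$ is invertible in $\widetilde A$ for all $a\in A$.
   Context: All algebras are complex. A normed $*$-algebra is a complex algebra $A$ with an involution $a\mapsto a^*$ (conjugate linear, $(ab)^*=b^*a^*$, $a^{**}=a$) and a norm $|\cdot|$ with $|ab|\le|a|\,|b|$; the involution is not assumed to be continuous. A Banach $*$-algebra is a complete normed $*$-algebra. $\widetilde A$ denotes $A$ if $A$ has a unit $e$, and otherwise the unitisation $\mathbb{C}e\oplus A$ with adjoined unit $e$ (with $(\lambda e+a)^*=\bar\lambda e+a^*$, $|\lambda e+a|=|\lambda|+|a|$). For $a\in A$, $\mathrm{sp}(a)=\{\lambda\in\mathbb{C}:\lambda e-a\text{ is not invertible in }\widetilde A\}$. For $a\in A$, $r_\lambda(a):=\inf_{n\ge1}|a^n|^{1/n}$ and $r_\sigma(a):=r_\lambda(a^*a)^{1/2}$. A $*$-algebra is Hermitian if every Hermitian element ($a=a^*$) has real spectrum. *)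

theory Defs
  imports "HOL-Analysis.Analysis"
begin

text \<open>A Banach *-algebra is modelled on a type 'a of class banach + real_normed_algebra
 (a possibly non-unital ring with a complete submultiplicative norm), together with a
 complex scalar multiplication cmul (extending scaleR) and an involution star,
 which is NOT assumed continuous.\<close>

definition banach_star_algebra ::
  "(complex \<Rightarrow> 'a::{banach, real_normed_algebra} \<Rightarrow> 'a) \<Rightarrow> ('a \<Rightarrow> 'a) \<Rightarrow> bool" where
  "banach_star_algebra cmul star \<longleftrightarrow>
     (\<forall>r x. cmul (complex_of_real r) x = scaleR r x) \<and>
     (\<forall>z x y. cmul z (x + y) = cmul z x + cmul z y) \<and>
     (\<forall>z w x. cmul (z + w) x = cmul z x + cmul w x) \<and>
     (\<forall>z w x. cmul (z * w) x = cmul z (cmul w x)) \<and>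
     (\<forall>z x y. cmul z (x * y) = cmul z x * y \<and> cmul z (x * y) = x * cmul z y) \<and>
     (\<forall>z x. norm (cmul z x) = cmod z * norm x) \<and>
     (\<forall>x y. star (x + y) = star x + star y) \<and>
     (\<forall>z x. star (cmul z x) = cmul (cnj z) (star x)) \<and>
     (\<forall>x y. star (x * y) = star y * star x) \<and>
     (\<forall>x. star (star x) = x)"

definition is_unit_of :: "'a::ring \<Rightarrow> bool" where
  "is_unit_of u \<longleftrightarrow> (\<forall>x. u * x = x \<and> x * u = x)"

definition has_unit :: "'a::ring itself \<Rightarrow> bool" where
  "has_unit _ \<longleftrightarrow> (\<exists>u::'a. is_unit_of u)"

text \<open>tilde_invertible cmul l a: the element l e + a is invertible in the unitisation
 \<open>A~\<close> (which is A itself if A has a unit e, and otherwise \<open>\<complex>e \<oplus> A\<close> with product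
 (l e + a)(m e + b) = l m e + (l b + m a + a b)).\<close>

definition tilde_invertible :: "(complex \<Rightarrow> 'a::ring \<Rightarrow> 'a) \<Rightarrow> complex \<Rightarrow> 'a \<Rightarrow> bool" where
  "tilde_invertible cmul l a \<longleftrightarrow>
     (if has_unit TYPE('a) then
        (let u = (SOME u::'a. is_unit_of u) in
          \<exists>y. (cmul l u + a) * y = u \<and> y * (cmul l u + a) = u)
      else
        (\<exists>m b. l * m = 1 \<and> cmul l b + cmul m a + a * b = 0
                          \<and> cmul m a + cmul l b + b * a = 0))"

definition spec :: "(complex \<Rightarrow> 'a::ring \<Rightarrow> 'a) \<Rightarrow> 'a \<Rightarrow> complex set" where
  "spec cmul a = {l. \<not> tilde_invertible cmul l (- a)}"

text \<open>npow a n = a^(n+1) (powers with positive exponent, no unit needed).\<close>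
fun npow :: "'a::ring \<Rightarrow> nat \<Rightarrow> 'a" where
  "npow a 0 = a"
| "npow a (Suc n) = a * npow a n"

definition r_lambda :: "'a::{ring, real_normed_vector} \<Rightarrow> real" where
  "r_lambda a = (INF n. root (Suc n) (norm (npow a n)))"

definition r_sigma :: "('a \<Rightarrow> 'a) \<Rightarrow> 'a::{ring, real_normed_vector} \<Rightarrow> real" where
  "r_sigma star a = sqrt (r_lambda (star a * a))"

definition hermitian :: "(complex \<Rightarrow> 'a::ring \<Rightarrow> 'a) \<Rightarrow> ('a \<Rightarrow> 'a) \<Rightarrow> bool" where
  "hermitian cmul star \<longleftrightarrow> (\<forall>a. star a = a \<longrightarrow> spec cmul a \<subseteq> \<real>)"

end

theory Submission
  imports Defs "HOL-Computational_Algebra.Fundamental_Theorem_Algebra"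
begin

text \<open>Nonzero spectral points of elements of A can be tested in the real unitization U of A,
  whether or not A has a unit: a nonzero \<lambda> lies outside sp(a) iff 1 - a/\<lambda> is invertible in U,
  and complex scalars are only ever needed on the ideal A of U.

  The transformation a \<mapsto> c acts on a*a by p(x) = x(\<beta> - x)^2/\<alpha>^2, which maps [0,1] into itself
  (this uses \<alpha> \<ge> 2) but pushes negative points away from 0 by a factor of at least (\<beta>/\<alpha>)^2.
  Iterating it shows that (iii) excludes negative points of sp(a*a). A non-real point \<lambda> of the
  spectrum of a Hermitian h gives any prescribed value of s \<lambda> + t \<lambda>^2 with real s, t; hence the
  square of the Hermitian element s h + t h^2 has a negative, or a non-real, spectral point.

  Conversely, let A be Hermitian. Ford's square root lemma yields Ptak's inequality, and therefore
  sums of positive elements are positive. Applied to a*a + aa* = (h^2 + k^2)/2, with Hermitian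
  h = a + a* and k = i(a - a*), this bounds the negative part of sp(a*a) by twice its positive
  part; the same iteration (with \<alpha> = 2) improves this bound to the absence of negative points.\<close>

section \<open>Invertible elements and power contractions\<close>

text \<open>Spectral points are parametrised by z = 1/\<lambda>, so that spectral statements take
  the form: \<open>1 - sc z x\<close> is invertible, with x in A. Two obstacles shape the analytic
  part. The spectral radius formula is needed in U, which has no complex structure; invertibility on
  a closed disc is turned into small powers by averaging resolvents over a rotation instead of by
  holomorphic functions. The involution may be discontinuous, so it cannot be applied to a power
  series term by term; it does transport invertibility, an algebraic notion, and the binomial square
  root is shown to be Hermitian by a uniqueness argument. The factor 2 between negative and positive
  part stems from x / (1 + x), which for real x > -1 has modulus less than 1 exactly when x > -1/2;
  Ptak's inequality then controls the product of x / (1 + x) and s / (1 + s) although x and s need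
  not commute.\<close>

definition invertible_elt :: "'b::ring_1 \<Rightarrow> bool" where
  "invertible_elt u \<longleftrightarrow> (\<exists>v. u * v = 1 \<and> v * u = 1)"

lemma invertible_elt_one [simp]: "invertible_elt 1"
  unfolding invertible_elt_def by (intro exI[of _ 1]) simp

lemma left_right_inverse_eq:
  fixes u :: "'b::ring_1"
  assumes "v * u = 1" "u * w = 1"
  shows "v = w"
  using assms by (metis mult.assoc mult_1_left mult_1_right)

lemma invertible_elt_left_right:
  fixes u :: "'b::ring_1"
  assumes "v * u = 1" "u * w = 1"
  shows "invertible_elt u"
  using assms left_right_inverse_eq unfolding invertible_elt_def by blast

lemma invertible_elt_mult:
  assumes "invertible_elt u" "invertible_elt v"
  shows "invertible_elt (u * v)"
proof -
  obtain u' v' where "u * u' = 1" "u' * u = 1" "v * v' = 1" "v' * v = 1"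
    using assms unfolding invertible_elt_def by blast
  then have "(u * v) * (v' * u') = 1" "(v' * u') * (u * v) = 1"
    by (metis mult.assoc mult_1_left)+
  then show ?thesis unfolding invertible_elt_def by blast
qed

text \<open>\<open>v * w\<close> is a right and \<open>w * v\<close> a left inverse of
  \<open>u\<close>. This carries invertibility of a polynomial in an element down to a single linear
  factor.\<close>

lemma invertible_elt_commuting_factor:
  assumes "invertible_elt (u * v)" "u * v = v * u"
  shows "invertible_elt u"
proof -
  obtain w where w: "u * v * w = 1" "w * (u * v) = 1"
    using assms unfolding invertible_elt_def by blast
  have "u * (v * w) = 1" using w by (simp add: mult.assoc)
  moreover have "(w * v) * u = 1" using w assms(2) by (simp add: mult.assoc)
  ultimately show ?thesis by (rule invertible_elt_left_right[rotated])
qed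

text \<open>With w the inverse of \<open>1 - x * y\<close>, the inverse of \<open>1 - y * x\<close>
  is \<open>1 + y * w * x\<close>. Hence a product and its reversal have the same nonzero
  spectrum.\<close>

lemma invertible_elt_one_minus_swap:
  assumes "invertible_elt (1 - x * y)"
  shows "invertible_elt (1 - y * x)"
proof -
  obtain w where w: "(1 - x * y) * w = 1" "w * (1 - x * y) = 1"
    using assms unfolding invertible_elt_def by blast
  have "(1 - y * x) * (1 + y * w * x) = 1 - y * x + y * ((1 - x * y) * w) * x"
    by (simp add: algebra_simps)
  moreover have "(1 + y * w * x) * (1 - y * x) = 1 - y * x + y * (w * (1 - x * y)) * x"
    by (simp add: algebra_simps)
  ultimately show ?thesis using w unfolding invertible_elt_def by auto
qed

lemma inverse_commutes:
  fixes u :: "'b::ring_1"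
  assumes "u * v = 1" "v * u = 1" "u * x = x * u"
  shows "v * x = x * v"
proof -
  have "v * x = v * (x * u) * v" using assms(1) by (simp add: mult.assoc)
  also have "\<dots> = (v * u) * x * v" using assms(3) by (simp add: mult.assoc)
  finally show ?thesis using assms(2) by simp
qed

text \<open>In a complex Banach algebra this says that the spectral radius of x is less than 1.\<close>

definition power_contracting :: "'b::real_normed_algebra_1 \<Rightarrow> bool" where
  "power_contracting x \<longleftrightarrow> (\<exists>n>0. norm (x ^ n) < 1)"

text \<open>Division with remainder by N: the quotient gives decay at the rate of the N-th root of
  t, the finitely many remainders go into the constant.\<close>

lemma power_contracting_geometric:
  fixes x :: "'b::real_normed_algebra_1"
  assumes "power_contracting x"
  obtains M \<rho> where "0 < M" "0 < \<rho>" "\<rho> < 1" "\<And>n. norm (x ^ n) \<le> M * \<rho> ^ n"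
proof -
  obtain N where N: "N > 0" "norm (x ^ N) < 1"
    using assms unfolding power_contracting_def by blast
  \<comment> \<open>The lower bound 1/2 keeps the rate positive even if \<open>x ^ N\<close> is 0;
    bounds here and later divide by it.\<close>
  define t where "t = max (norm (x ^ N)) (1/2)"
  have t: "0 < t" "t < 1" "norm (x ^ N) \<le> t" using N by (auto simp: t_def)
  define r where "r = root N t"
  have r: "0 < r" "r < 1" "r ^ N = t" using t N by (auto simp: r_def)
  define K where "K = (1 + norm x) ^ N"
  have K: "0 < K" unfolding K_def by (intro zero_less_power) (simp add: add_pos_nonneg)
  have bound: "norm (x ^ n) \<le> K / t * r ^ n" for n
  proof -
    define q s where "q = n div N" and "s = n mod N"
    have n: "n = N * q + s" and s: "s < N" using N by (auto simp: q_def s_def)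
    have "norm (x ^ n) \<le> norm ((x ^ N) ^ q) * norm (x ^ s)"
      unfolding n power_add power_mult by (rule norm_mult_ineq)
    also have "\<dots> \<le> t ^ q * K"
    proof (rule mult_mono)
      show "norm ((x ^ N) ^ q) \<le> t ^ q"
        by (rule order_trans[OF norm_power_ineq]) (intro power_mono t norm_ge_zero)
      have "norm (x ^ s) \<le> (1 + norm x) ^ s"
        by (rule order_trans[OF norm_power_ineq]) (intro power_mono, auto)
      also have "\<dots> \<le> K" unfolding K_def using s by (intro power_increasing) auto
      finally show "norm (x ^ s) \<le> K" .
    qed (use t K in auto)
    also have "t ^ q * K = K / t * (r ^ N * r ^ (N * q))"
      using t by (simp add: r power_mult)
    also have "\<dots> \<le> K / t * (r ^ s * r ^ (N * q))"
      using s t K r by (intro mult_left_mono mult_right_mono power_decreasing) auto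
    also have "r ^ s * r ^ (N * q) = r ^ n" by (simp add: n power_add)
    finally show ?thesis .
  qed
  show ?thesis by (rule that[of "K / t" r]) (use bound K t r in auto)
qed

lemma power_contractingI_geometric:
  fixes x :: "'b::real_normed_algebra_1"
  assumes "\<And>n. norm (x ^ n) \<le> M * \<rho> ^ n" "0 \<le> \<rho>" "\<rho> < 1"
  shows "power_contracting x"
proof -
  have "(\<lambda>n. M * \<rho> ^ n) \<longlonglongrightarrow> M * 0"
    using assms by (intro tendsto_intros LIMSEQ_realpow_zero) auto
  then have "\<forall>\<^sub>F n in sequentially. M * \<rho> ^ n < 1" using order_tendstoD(2)[of _ "0::real" sequentially 1] by simp
  then have "\<forall>\<^sub>F n in sequentially. n > 0 \<and> M * \<rho> ^ n < 1"
    using eventually_gt_at_top eventually_conj by blast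
  then obtain n where "n > 0" "M * \<rho> ^ n < 1" by (auto simp: eventually_sequentially)
  then show ?thesis using assms(1)[of n] unfolding power_contracting_def by force
qed

lemma power_contracting_tendsto_zero:
  fixes x :: "'b::real_normed_algebra_1"
  assumes "power_contracting x"
  shows "(\<lambda>n. x ^ n) \<longlonglongrightarrow> 0"
proof -
  obtain M r where *: "0 < M" "0 < r" "r < 1" "\<And>n. norm (x ^ n) \<le> M * r ^ n"
    using power_contracting_geometric[OF assms] by blast
  have "(\<lambda>n. M * r ^ n) \<longlonglongrightarrow> M * 0"
    using * by (intro tendsto_intros LIMSEQ_realpow_zero) auto
  then have "(\<lambda>n. M * r ^ n) \<longlonglongrightarrow> 0" by simp
  then show ?thesis by (rule Lim_null_comparison[rotated]) (use * in auto)
qed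

lemma power_contracting_invertible:
  fixes x :: "'b::{real_normed_algebra_1, banach}"
  assumes "power_contracting x"
  shows "invertible_elt (1 - x)"
proof -
  obtain M r where *: "0 < M" "0 < r" "r < 1" "\<And>n. norm (x ^ n) \<le> M * r ^ n"
    using power_contracting_geometric[OF assms] by blast
  have sm: "summable (\<lambda>n. x ^ n)"
    by (rule summable_comparison_test[of _ "\<lambda>n. M * r ^ n"])
       (use * in \<open>auto intro!: summable_mult summable_geometric\<close>)
  define S where "S = (\<Sum>n. x ^ n)"
  have "(\<Sum>n. x ^ Suc n) = S - 1"
    unfolding S_def using suminf_split_head[OF sm] by simp
  moreover have "(\<Sum>n. x ^ Suc n) = x * S"
    unfolding S_def using suminf_mult[OF sm, of x] by simp
  moreover have "(\<Sum>n. x ^ Suc n) = S * x"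
    unfolding S_def power_Suc2 using suminf_mult2[OF sm, of x] by simp
  ultimately have "(1 - x) * S = 1" "S * (1 - x) = 1" by (simp_all add: algebra_simps)
  then show ?thesis unfolding invertible_elt_def by blast
qed

lemma power_mult_swap: "(y * x) ^ Suc n = y * (x * y) ^ n * (x::'b::monoid_mult)"
  by (induction n) (simp_all add: mult.assoc)

lemma power_contracting_swap:
  fixes x y :: "'b::real_normed_algebra_1"
  assumes "power_contracting (x * y)"
  shows "power_contracting (y * x)"
proof -
  obtain M r where *: "0 < M" "0 < r" "r < 1" "\<And>n. norm ((x * y) ^ n) \<le> M * r ^ n"
    using power_contracting_geometric[OF assms] by blast
  have bound: "norm ((y * x) ^ n) \<le> (1 + norm y * M * norm x / r) * r ^ n" for n
  proof (cases n)
    case 0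
    then show ?thesis using * by simp
  next
    case (Suc m)
    have "norm ((y * x) ^ n) \<le> norm y * norm ((x * y) ^ m) * norm x"
      unfolding Suc power_mult_swap
      by (meson norm_ge_zero norm_mult_ineq mult_right_mono order_trans)
    also have "\<dots> \<le> norm y * (M * r ^ m) * norm x"
      using * by (intro mult_left_mono mult_right_mono) auto
    also have "\<dots> = (norm y * M * norm x / r) * r ^ n" using * by (simp add: Suc field_simps)
    also have "\<dots> \<le> (1 + norm y * M * norm x / r) * r ^ n"
      using * by (intro mult_right_mono) auto
    finally show ?thesis .
  qed
  show ?thesis by (rule power_contractingI_geometric[OF bound]) (use * in auto)
qed

text \<open>Subadditivity of the spectral radius on commuting elements, from norm estimates only.
  The induction carries factors \<open>u ^ i * v ^ j\<close>, so each factor \<open>u + v\<close>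
  merely raises an exponent and the constant \<open>M * L\<close> does not grow.\<close>

lemma power_contracting_commuting_average:
  fixes u v :: "'b::real_normed_algebra_1"
  assumes "power_contracting u" "power_contracting v" "u * v = v * u"
  shows "power_contracting ((u + v) /\<^sub>R 2)"
proof -
  obtain M r where 1: "0 < M" "0 < r" "r < 1" "\<And>n. norm (u ^ n) \<le> M * r ^ n"
    using power_contracting_geometric[OF assms(1)] by blast
  obtain L s where 2: "0 < L" "0 < s" "s < 1" "\<And>n. norm (v ^ n) \<le> L * s ^ n"
    using power_contracting_geometric[OF assms(2)] by blast
  have comm: "u ^ n * v = v * u ^ n" for n
    by (metis assms(3) power_commuting_commutes)
  have bd: "norm ((u + v) ^ n * u ^ i * v ^ j) \<le> M * L * (r + s) ^ n * r ^ i * s ^ j" for n i j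
  proof (induction n arbitrary: i j)
    case 0
    have "norm (u ^ i * v ^ j) \<le> (M * r ^ i) * (L * s ^ j)"
      by (rule order_trans[OF norm_mult_ineq]) (intro mult_mono 1 2, use 1 in auto)
    then show ?case by (simp add: mult_ac)
  next
    case (Suc n)
    have "v * u ^ i * v ^ j = u ^ i * v ^ Suc j" 
      by (simp add: comm[symmetric] mult.assoc)
    then have eq: "(u + v) ^ Suc n * u ^ i * v ^ j
        = (u + v) ^ n * u ^ Suc i * v ^ j + (u + v) ^ n * u ^ i * v ^ Suc j"
      unfolding power_Suc2[of "u + v"] by (simp add: algebra_simps)
    have "norm ((u + v) ^ Suc n * u ^ i * v ^ j)
        \<le> M * L * (r + s) ^ n * r ^ Suc i * s ^ j + M * L * (r + s) ^ n * r ^ i * s ^ Suc j"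
      unfolding eq by (rule norm_triangle_le) (intro add_mono Suc)
    also have "\<dots> = M * L * (r + s) ^ Suc n * r ^ i * s ^ j" by (simp add: algebra_simps)
    finally show ?case .
  qed
  have "norm (((u + v) /\<^sub>R 2) ^ n) \<le> M * L * ((r + s) / 2) ^ n" for n
  proof -
    have "((u + v) /\<^sub>R 2) ^ n = (1/2) ^ n *\<^sub>R (u + v) ^ n"
      by (simp only: scaleR_power inverse_eq_divide)
    then have "norm (((u + v) /\<^sub>R 2) ^ n) = (1/2) ^ n * norm ((u + v) ^ n)"
      by (simp only: norm_scaleR) (simp only: abs_of_nonneg zero_le_power zero_le_divide_1_iff zero_le_numeral)
    also have "\<dots> \<le> (1/2) ^ n * (M * L * (r + s) ^ n)"
      using bd[of n 0 0] by (intro mult_left_mono) auto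
    also have "\<dots> = M * L * ((r + s) / 2) ^ n" by (simp add: power_divide)
    finally show ?thesis .
  qed
  then show ?thesis by (rule power_contractingI_geometric) (use 1 2 in auto)
qed

section \<open>The resolvent and the spectral radius\<close>

text \<open>The pattern is A inside its unitization. For z \<noteq> 0, \<open>1 - sc z x\<close> is
  singular exactly when 1/z is a spectral point of x.\<close>

locale complex_ideal =
  fixes I :: "'b::{real_normed_algebra_1, banach} set"
    and sc :: "complex \<Rightarrow> 'b \<Rightarrow> 'b"
  assumes I_zero: "0 \<in> I"
    and I_add: "x \<in> I \<Longrightarrow> y \<in> I \<Longrightarrow> x + y \<in> I"
    and I_scaleR: "x \<in> I \<Longrightarrow> r *\<^sub>R x \<in> I"
    and I_mult_left: "x \<in> I \<Longrightarrow> u * x \<in> I"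
    and I_mult_right: "x \<in> I \<Longrightarrow> x * u \<in> I"
    and sc_in_I: "x \<in> I \<Longrightarrow> sc z x \<in> I"
    and sc_of_real: "x \<in> I \<Longrightarrow> sc (complex_of_real r) x = r *\<^sub>R x"
    and sc_add_left: "x \<in> I \<Longrightarrow> sc (z + w) x = sc z x + sc w x"
    and sc_add_right: "x \<in> I \<Longrightarrow> y \<in> I \<Longrightarrow> sc z (x + y) = sc z x + sc z y"
    and sc_sc: "x \<in> I \<Longrightarrow> sc z (sc w x) = sc (z * w) x"
    and mult_sc: "x \<in> I \<Longrightarrow> u * sc z x = sc z (u * x)"
    and sc_mult: "x \<in> I \<Longrightarrow> sc z x * u = sc z (x * u)"
    and norm_sc: "x \<in> I \<Longrightarrow> norm (sc z x) = cmod z * norm x"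
begin

lemma I_minus: "x \<in> I \<Longrightarrow> - x \<in> I"
  using I_scaleR[of x "-1"] by simp

lemma I_diff: "x \<in> I \<Longrightarrow> y \<in> I \<Longrightarrow> x - y \<in> I"
  using I_add[of x "- y"] I_minus by simp

lemma I_power: "x \<in> I \<Longrightarrow> n > 0 \<Longrightarrow> x ^ n \<in> I"
  by (cases n) (auto simp: I_mult_right)

lemmas I_intros = I_zero I_add I_diff I_minus I_scaleR I_mult_left I_mult_right sc_in_I

lemma sc_one [simp]: "x \<in> I \<Longrightarrow> sc 1 x = x"
  using sc_of_real[of x 1] by simp

lemma sc_zero [simp]: "x \<in> I \<Longrightarrow> sc 0 x = 0"
  using sc_of_real[of x 0] by simp

lemma sc_minus_left: "x \<in> I \<Longrightarrow> sc (- z) x = - sc z x"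
  using sc_add_left[of x z "- z"] by (simp add: eq_neg_iff_add_eq_0 add.commute)

lemma sc_diff_left: "x \<in> I \<Longrightarrow> sc (z - w) x = sc z x - sc w x"
  using sc_add_left[of x z "- w"] by (simp add: sc_minus_left)

lemma sc_scaleR: "x \<in> I \<Longrightarrow> sc z (r *\<^sub>R x) = r *\<^sub>R sc z x"
  by (metis sc_in_I sc_of_real sc_sc mult.commute)

lemma sc_minus_right: "x \<in> I \<Longrightarrow> sc z (- x) = - sc z x"
  using sc_scaleR[of x z "-1"] by simp

lemma sc_diff_right: "x \<in> I \<Longrightarrow> y \<in> I \<Longrightarrow> sc z (x - y) = sc z x - sc z y"
  using sc_add_right[of x "- y" z] by (simp add: sc_minus_right I_minus)

lemma sc_mult_sc: "x \<in> I \<Longrightarrow> y \<in> I \<Longrightarrow> sc z x * sc w y = sc (z * w) (x * y)"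
  by (simp add: mult_sc sc_mult sc_sc I_intros mult.commute)

lemma power_sc: "x \<in> I \<Longrightarrow> n > 0 \<Longrightarrow> sc z x ^ n = sc (z ^ n) (x ^ n)"
proof (induction n)
  case (Suc n)
  then show ?case by (cases "n = 0") (simp_all add: sc_mult_sc I_power)
qed simp

lemma resolvent_difference:
  assumes x: "x \<in> I" and u: "(1 - sc z x) * u = 1" "u * (1 - sc z x) = 1"
    and v: "(1 - sc w x) * v = 1" "v * (1 - sc w x) = 1"
  shows "u - v = u * sc (z - w) x * v"
proof -
  have "u * sc (z - w) x * v = u * ((1 - sc w x) - (1 - sc z x)) * v"
    by (simp add: sc_diff_left x)
  also have "\<dots> = u * ((1 - sc w x) * v) - (u * (1 - sc z x)) * v" by (simp only: algebra_simps)
  finally show ?thesis using u v by simp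
qed

definition rinv :: "'b \<Rightarrow> 'b" where
  "rinv u = (SOME v. u * v = 1 \<and> v * u = 1)"

lemma rinv:
  assumes "invertible_elt u"
  shows "u * rinv u = 1" "rinv u * u = 1"
  using someI_ex[OF assms[unfolded invertible_elt_def]] unfolding rinv_def by auto

lemma rinv_unique: "u * v = 1 \<Longrightarrow> v * u = 1 \<Longrightarrow> rinv u = v"
  using left_right_inverse_eq rinv(2) unfolding invertible_elt_def by blast

lemma continuous_on_resolvent:
  assumes x: "x \<in> I" and inv: "\<And>z. z \<in> D \<Longrightarrow> invertible_elt (1 - sc z x)"
  shows "continuous_on D (\<lambda>z. rinv (1 - sc z x))"
  unfolding continuous_on_iff
proof (intro ballI allI impI)
  fix w e assume w: "w \<in> D" and e: "(e::real) > 0"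
  define R where "R z = rinv (1 - sc z x)" for z
  \<comment> \<open>K makes the factor next to \<open>norm (R z)\<close> in the resolvent identity
    at most 1/2, which bounds \<open>R z\<close> by \<open>2 * norm (R w)\<close>; L bounds what
    then remains. The added 1 keeps both positive.\<close>
  define K where "K = norm (R w) * norm x + 1"
  define L where "L = 2 * norm (R w) * norm x * norm (R w) + 1"
  have K: "K > 0" and L: "L > 0" by (auto simp: K_def L_def intro!: add_nonneg_pos)
  define d where "d = min (1 / (2 * K)) (e / L)"
  have d: "d > 0" using K L e by (simp add: d_def)
  have "dist (R z) (R w) < e" if z: "z \<in> D" and zw: "dist z w < d" for z
  proof -
    have eq: "R z - R w = R z * sc (z - w) x * R w"
      unfolding R_def by (intro resolvent_difference x rinv inv z w)
    have le: "norm (R z - R w) \<le> norm (R z) * (cmod (z - w) * norm x) * norm (R w)"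
      unfolding eq norm_sc[OF x, symmetric]
      by (meson norm_ge_zero norm_mult_ineq mult_right_mono order_trans)
    have zw': "cmod (z - w) \<le> 1 / (2 * K)" "cmod (z - w) < e / L"
      using zw by (auto simp: d_def dist_norm)
    have "cmod (z - w) * (norm (R w) * norm x) \<le> 1 / (2 * K) * K"
      by (rule mult_mono) (use zw' K in \<open>auto simp: K_def\<close>)
    then have half: "cmod (z - w) * (norm (R w) * norm x) \<le> 1 / 2" using K by simp
    have "norm (R z) * (cmod (z - w) * norm x) * norm (R w) \<le> norm (R z) * (1 / 2)"
      using mult_left_mono[OF half, of "norm (R z)"] by (simp add: mult_ac)
    then have "norm (R z - R w) \<le> norm (R z) / 2" using le by simp
    then have "norm (R z) \<le> 2 * norm (R w)"
      using norm_triangle_ineq2[of "R z" "R w"] by linarith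
    then have "norm (R z) * (cmod (z - w) * norm x) * norm (R w)
        \<le> 2 * norm (R w) * (cmod (z - w) * norm x) * norm (R w)"
      by (intro mult_right_mono) auto
    also have "\<dots> = cmod (z - w) * (2 * norm (R w) * norm x * norm (R w))" by simp
    also have "\<dots> \<le> cmod (z - w) * L" by (intro mult_left_mono) (auto simp: L_def)
    also have "\<dots> < e" using zw'(2) L by (simp add: field_simps)
    finally show ?thesis using le by (simp add: dist_norm)
  qed
  then show "\<exists>d>0. \<forall>z\<in>D. dist z w < d \<longrightarrow> dist (rinv (1 - sc z x)) (rinv (1 - sc w x)) < e"
    using d unfolding R_def by blast
qed

section \<open>From invertibility on the closed unit disc to small powers\<close>

lemma complex_root_minus_one:
  obtains \<zeta> :: complex where "\<zeta> ^ (2 ^ m) = -1" "cmod \<zeta> = 1"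
proof
  show "cis (pi / 2 ^ m) ^ (2 ^ m) = -1" unfolding Complex.DeMoivre by simp
qed simp

text \<open>The resolvent of the square is the average of two resolvents:
  (1 - y^2)^(-1) = ((1 - y)^(-1) + (1 + y)^(-1)) / 2. Iterating, the modulus of continuity of
  the resolvent on the disc is inherited by the resolvents of all powers with exponent 2^m.\<close>

lemma resolvent_power_equicontinuous:
  assumes x: "x \<in> I" and inv: "\<And>z. cmod z \<le> 1 \<Longrightarrow> invertible_elt (1 - sc z x)"
    and eq: "\<And>z w. \<lbrakk>cmod z \<le> 1; cmod w \<le> 1; cmod (z - w) < d\<rbrakk>
        \<Longrightarrow> norm (rinv (1 - sc z x) - rinv (1 - sc w x)) \<le> e"
    and "cmod z \<le> 1" "cmod w \<le> 1" "cmod (z - w) < d"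
  shows "invertible_elt (1 - sc z x ^ 2 ^ m) \<and>
    norm (rinv (1 - sc z x ^ 2 ^ m) - rinv (1 - sc w x ^ 2 ^ m)) \<le> e"
  using assms(4-)
proof (induction m arbitrary: z w)
  case 0
  then show ?case using inv eq by simp
next
  case (Suc m)
  \<comment> \<open>Multiplying the parameter by \<zeta> changes the sign of the power with exponent
    2^m, so \<open>1 + y\<close> is also covered by the induction hypothesis; as an isometry of the
    disc it keeps the distance below d.\<close>
  obtain \<zeta> :: complex where \<zeta>: "\<zeta> ^ (2 ^ m) = -1" "cmod \<zeta> = 1"
    using complex_root_minus_one by blast
  have pw: "sc (\<zeta> * v) x ^ 2 ^ m = - (sc v x ^ 2 ^ m)" for v
    by (simp add: power_sc x \<zeta> power_mult_distrib sc_minus_left I_power)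
  have fac: "invertible_elt (1 - sc v x ^ 2 ^ Suc m) \<and> rinv (1 - sc v x ^ 2 ^ Suc m)
      = (rinv (1 - sc v x ^ 2 ^ m) + rinv (1 - sc (\<zeta> * v) x ^ 2 ^ m)) /\<^sub>R 2"
    if "cmod v \<le> 1" for v
  proof -
    define y where "y = sc v x ^ 2 ^ m"
    define p q where "p = rinv (1 - y)" and "q = rinv (1 + y)"
    \<comment> \<open>Positive d admits the induction hypothesis at two equal points, where it
      yields invertibility.\<close>
    have "0 < d" using Suc.prems(3) norm_ge_zero order_le_less_trans by blast
    then have "invertible_elt (1 - y)" "invertible_elt (1 - sc (\<zeta> * v) x ^ 2 ^ m)"
      unfolding y_def using that \<zeta> Suc.IH[of v v] Suc.IH[of "\<zeta> * v" "\<zeta> * v"]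
      by (auto simp: norm_mult)
    then have p: "(1 - y) * p = 1" "p * (1 - y) = 1" and q: "(1 + y) * q = 1" "q * (1 + y) = 1"
      using rinv unfolding pw y_def p_def q_def by auto
    have y2: "1 - sc v x ^ 2 ^ Suc m = (1 - y) * (1 + y)" "1 - sc v x ^ 2 ^ Suc m = (1 + y) * (1 - y)"
      by (simp_all add: y_def algebra_simps flip: power_add mult_2)
    define s where "s = (p + q) /\<^sub>R 2"
    define Y where "Y = 1 - sc v x ^ 2 ^ Suc m"
    have Y: "Y = (1 - y) * (1 + y)" "Y = (1 + y) * (1 - y)" using y2 by (simp_all only: Y_def)
    have "Y * p = (1 + y) * ((1 - y) * p)" by (simp only: Y(2) mult.assoc)
    moreover have "Y * q = (1 - y) * ((1 + y) * q)" by (simp only: Y(1) mult.assoc)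
    ultimately have "Y * (p + q) = 2 *\<^sub>R 1" unfolding p q by (simp add: scaleR_2 distrib_left)
    then have 1: "(1 - sc v x ^ 2 ^ Suc m) * s = 1" by (simp add: s_def Y_def)
    have "p * Y = (p * (1 - y)) * (1 + y)" by (simp only: Y(1) mult.assoc)
    moreover have "q * Y = (q * (1 + y)) * (1 - y)" by (simp only: Y(2) mult.assoc)
    ultimately have "(p + q) * Y = 2 *\<^sub>R 1" unfolding p q by (simp add: scaleR_2 distrib_right)
    then have 2: "s * (1 - sc v x ^ 2 ^ Suc m) = 1" by (simp add: s_def Y_def)
    have "invertible_elt (1 - sc v x ^ 2 ^ Suc m)" using 1 2 unfolding invertible_elt_def by blast
    then show ?thesis using rinv_unique[OF 1 2]
      unfolding s_def p_def q_def y_def pw by simp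
  qed
  have z: "cmod (\<zeta> * z) \<le> 1" "cmod (\<zeta> * w) \<le> 1" "cmod (\<zeta> * z - \<zeta> * w) < d"
    using Suc.prems \<zeta> by (auto simp: norm_mult simp flip: right_diff_distrib)
  define A B where "A = rinv (1 - sc z x ^ 2 ^ m) - rinv (1 - sc w x ^ 2 ^ m)"
    and "B = rinv (1 - sc (\<zeta> * z) x ^ 2 ^ m) - rinv (1 - sc (\<zeta> * w) x ^ 2 ^ m)"
  have AB: "norm A \<le> e" "norm B \<le> e" unfolding A_def B_def using Suc.IH Suc.prems z by blast+
  have "rinv (1 - sc z x ^ 2 ^ Suc m) - rinv (1 - sc w x ^ 2 ^ Suc m) = (A + B) /\<^sub>R 2"
    using fac[OF Suc.prems(1)] fac[OF Suc.prems(2)]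
    by (simp add: A_def B_def algebra_simps)
  moreover have "norm ((A + B) /\<^sub>R 2) \<le> e"
    using AB norm_triangle_ineq[of A B] by simp
  ultimately show ?case using fac[OF Suc.prems(1)] by metis
qed

text \<open>From y = (1 - y)(u - 1) follows norm y \<le> (1 + norm y)/3.\<close>

lemma norm_le_half_of_resolvent_near_one:
  assumes "(1 - y) * u = (1::'b)" "norm (u - 1) \<le> 1/3"
  shows "norm y \<le> 1/2"
proof -
  have "y = (1 - y) * (u - 1)"
    using assms(1) by (simp add: algebra_simps)
  then have "norm y \<le> norm (1 - y) * norm (u - 1)" by (metis norm_mult_ineq)
  also have "\<dots> \<le> (1 + norm y) * (1/3)"
    using assms(2) norm_triangle_ineq4[of 1 y] by (intro mult_mono) auto
  finally show ?thesis by simp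
qed

text \<open>For the inverse u, u - 1 = u y gives norm (u - 1) \<le> (1 + norm (u - 1))/8, hence at
  most 1/7.\<close>

lemma resolvent_near_one:
  assumes "norm y < 1/8"
  shows "invertible_elt (1 - y :: 'b)" "norm (rinv (1 - y) - 1) \<le> 1/6"
proof -
  have "power_contracting y" unfolding power_contracting_def using assms by (intro exI[of _ 1]) auto
  then show i: "invertible_elt (1 - y)" by (rule power_contracting_invertible)
  define u where "u = rinv (1 - y)"
  have "u * (1 - y) = 1" unfolding u_def using rinv i by blast
  then have u: "u = 1 + u * y" by (simp add: algebra_simps)
  then have "norm (u - 1) = norm (u * y)" by (metis add_diff_cancel_left')
  also have "\<dots> \<le> norm u * norm y" by (rule norm_mult_ineq)
  also have "\<dots> \<le> (1 + norm (u - 1)) * (1/8)"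
    using assms norm_triangle_ineq[of 1 "u - 1"] by (intro mult_mono) auto
  finally show "norm (rinv (1 - y) - 1) \<le> 1/6" by (simp add: u_def)
qed

text \<open>The hard half of the spectral radius formula, by continuation along
  \<open>t *\<^sub>R x\<close> from t = 0 to t = 1. If \<open>s *\<^sub>R x\<close> is contracting,
  some power of it with exponent 2^m is small and has resolvent within 1/6 of 1. Equicontinuity,
  uniform in m, moves the resolvent by at most 1/6 when s is replaced by a nearby t, so the same
  power of \<open>t *\<^sub>R x\<close> has norm at most 1/2.\<close>

theorem power_contracting_of_resolvent_on_disc:
  assumes x: "x \<in> I" and inv: "\<And>z. cmod z \<le> 1 \<Longrightarrow> invertible_elt (1 - sc z x)"
  shows "power_contracting x"
proof -
  have "uniformly_continuous_on (cball 0 1) (\<lambda>z. rinv (1 - sc z x))"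
    by (intro compact_uniformly_continuous continuous_on_resolvent x inv) auto
  then have "\<exists>d>0. \<forall>z\<in>cball 0 1. \<forall>w\<in>cball 0 1. dist w z < d
      \<longrightarrow> dist (rinv (1 - sc w x)) (rinv (1 - sc z x)) < 1/6"
    unfolding uniformly_continuous_on_def by (rule spec[where x="1/6", THEN mp]) simp
  then obtain d where d: "d > 0" and dd: "\<And>z w. \<lbrakk>cmod z \<le> 1; cmod w \<le> 1; cmod (z - w) < d\<rbrakk>
        \<Longrightarrow> norm (rinv (1 - sc z x) - rinv (1 - sc w x)) < 1/6"
    by (auto simp: dist_norm)
  have key: "invertible_elt (1 - sc z x ^ 2 ^ m)"
    "norm (rinv (1 - sc z x ^ 2 ^ m) - rinv (1 - sc w x ^ 2 ^ m)) \<le> 1/6"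
    if "cmod z \<le> 1" "cmod w \<le> 1" "cmod (z - w) < d" for z w m
    using resolvent_power_equicontinuous[OF x inv, of d "1/6" z w m] that dd less_imp_le by blast+
  have step: "power_contracting (t *\<^sub>R x)"
    if s: "0 \<le> s" "s \<le> t" "t \<le> 1" "t - s < d" and pc: "power_contracting (s *\<^sub>R x)" for s t :: real
  proof -
    have "(\<lambda>n. (s *\<^sub>R x) ^ 2 ^ n) \<longlonglongrightarrow> 0"
      using LIMSEQ_subseq_LIMSEQ[OF power_contracting_tendsto_zero[OF pc], of "\<lambda>n. 2 ^ n"]
      by (simp add: strict_mono_def o_def)
    then have "\<forall>\<^sub>F n in sequentially. norm ((s *\<^sub>R x) ^ 2 ^ n) < 1/8"
      using tendsto_norm_zero order_tendstoD(2)[of _ "0::real" sequentially "1/8"] by fastforce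
    then obtain m where m: "norm ((s *\<^sub>R x) ^ 2 ^ m) < 1/8"
      by (auto simp: eventually_sequentially)
    define u where "u = rinv (1 - (t *\<^sub>R x) ^ 2 ^ m)"
    define v where "v = rinv (1 - (s *\<^sub>R x) ^ 2 ^ m)"
    have sct: "cmod (of_real t) \<le> 1" "cmod (of_real s) \<le> 1" "cmod (of_real t - of_real s) < d"
      using s by (auto simp flip: of_real_diff)
    have "norm (u - v) \<le> 1/6" using key(2)[OF sct, of m] by (simp add: u_def v_def sc_of_real x)
    moreover have "norm (v - 1) \<le> 1/6" unfolding v_def by (rule resolvent_near_one(2)[OF m])
    ultimately have "norm (u - 1) \<le> 1/3" using norm_triangle_ineq[of "u - v" "v - 1"] by simp
    moreover have "(1 - (t *\<^sub>R x) ^ 2 ^ m) * u = 1"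
      using key(1)[OF sct, of m] rinv(1) by (simp add: u_def sc_of_real x)
    ultimately have "norm ((t *\<^sub>R x) ^ 2 ^ m) \<le> 1/2" by (rule norm_le_half_of_resolvent_near_one[rotated])
    then show ?thesis unfolding power_contracting_def by (intro exI[of _ "2 ^ m"]) auto
  qed
  \<comment> \<open>Steps of length d/2 stay below d, and \<open>min\<close> makes the walk end
    exactly at 1.\<close>
  have all: "power_contracting (min 1 (real k * (d/2)) *\<^sub>R x)" for k
  proof (induction k)
    case 0
    show ?case unfolding power_contracting_def by (intro exI[of _ 1]) auto
  next
    case (Suc k)
    show ?case by (rule step[OF _ _ _ _ Suc]) (use d in \<open>auto simp: min_def field_simps\<close>)
  qed
  obtain k where "real k * (d/2) \<ge> 1"
    using reals_Archimedean3[of "d/2"] d less_imp_le by (metis half_gt_zero)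
  then show ?thesis using all[of k] by (simp add: min_def)
qed

end

section \<open>The binomial square root\<close>

text \<open>Taylor coefficients of sqrt(1 - t) at t = 0.\<close>

definition sqrt_coeff :: "nat \<Rightarrow> real" where
  "sqrt_coeff n = (1/2 gchoose n) * (- 1) ^ n"

lemma sqrt_coeff_zero [simp]: "sqrt_coeff 0 = 1"
  by (simp add: sqrt_coeff_def)

lemma sqrt_coeff_Suc: "sqrt_coeff (Suc n) = sqrt_coeff n * (real n - 1/2) / (real n + 1)"
proof -
  have "real (Suc n) * (1/2 gchoose Suc n) = (1/2 - real n) * ((1/2::real) gchoose n)"
    using gbinomial_mult_1[of "1/2::real" n] by (simp add: algebra_simps)
  then have "((1/2::real) gchoose Suc n) = (1/2 gchoose n) * (1/2 - real n) / (real n + 1)"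
    by (simp add: field_simps)
  then show ?thesis unfolding sqrt_coeff_def power_Suc by (simp only: times_divide_eq_left) (simp add: algebra_simps)
qed

text \<open>In the recursion the factor n - 1/2 is negative only at n = 0. Thus 1 - sqrt(1 - t) has
  nonnegative coefficients and its absolute series at \<rho> sums to 1 - sqrt(1 - \<rho>), which is
  below 1 for \<rho> < 1.\<close>

lemma sqrt_coeff_nonpos: "sqrt_coeff (Suc n) \<le> 0"
proof (induction n)
  case 0
  show ?case by (simp add: sqrt_coeff_Suc)
next
  case (Suc n)
  have "sqrt_coeff (Suc n) * ((real (Suc n) - 1/2) / (real (Suc n) + 1)) \<le> 0"
    by (intro mult_nonpos_nonneg Suc divide_nonneg_nonneg) auto
  then show ?case unfolding sqrt_coeff_Suc[of "Suc n"] by simp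
qed

lemma sqrt_coeff_sums:
  assumes "0 \<le> \<rho>" "\<rho> < 1"
  shows "(\<lambda>n. sqrt_coeff n * \<rho> ^ n) sums sqrt (1 - \<rho>)"
proof -
  have "(\<lambda>n. (1/2 gchoose n) * (- \<rho>) ^ n) sums (1 + - \<rho>) powr (1/2)"
    using assms by (intro gen_binomial_real) simp
  moreover have "(- \<rho>) ^ n = (-1) ^ n * \<rho> ^ n" for n by (rule power_minus)
  ultimately show ?thesis using assms by (simp add: sqrt_coeff_def powr_half_sqrt mult.assoc)
qed

lemma summable_abs_sqrt_coeff:
  assumes "0 \<le> \<rho>" "\<rho> < 1"
  shows "summable (\<lambda>n. \<bar>sqrt_coeff n\<bar> * \<rho> ^ n)"
proof -
  have "summable (\<lambda>n. - (sqrt_coeff (Suc n) * \<rho> ^ Suc n))"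
    using sqrt_coeff_sums[OF assms] by (intro summable_minus) (simp only: summable_Suc_iff[of "\<lambda>n. sqrt_coeff n * \<rho> ^ n"] sums_iff)
  then have "summable (\<lambda>n. \<bar>sqrt_coeff (Suc n)\<bar> * \<rho> ^ Suc n)"
    using sqrt_coeff_nonpos by (simp add: abs_of_nonpos)
  then show ?thesis using summable_Suc_iff by blast
qed

text \<open>Vandermonde with 1/2 + 1/2 = 1: the Cauchy square of the series is 1 - t.\<close>

lemma sqrt_coeff_convolution:
  "(\<Sum>i\<le>k. sqrt_coeff i * sqrt_coeff (k - i)) = (if k = 0 then 1 else if k = 1 then -1 else 0)"
proof -
  have "(\<Sum>i\<le>k. sqrt_coeff i * sqrt_coeff (k - i))
      = (\<Sum>i\<le>k. (-1) ^ k * ((1/2 gchoose i) * (1/2 gchoose (k - i))))"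
  proof (rule sum.cong)
    fix i assume "i \<in> {..k}"
    then have "(-1::real) ^ k = (-1) ^ i * (-1) ^ (k - i)" by (simp only: atMost_iff le_add_diff_inverse flip: power_add)
    then show "sqrt_coeff i * sqrt_coeff (k - i)
        = (-1) ^ k * ((1/2 gchoose i) * (1/2 gchoose (k - i)))"
      unfolding sqrt_coeff_def by (simp only: mult_ac)
  qed simp
  also have "\<dots> = (-1) ^ k * ((1/2 + 1/2 :: real) gchoose k)"
    by (simp only: sum_distrib_left[symmetric] atMost_atLeast0 gbinomial_Vandermonde)
  also have "(1/2 + 1/2 :: real) gchoose k = of_nat (1 choose k)"
    unfolding binomial_gbinomial by simp
  also have "(-1) ^ k * real (1 choose k) = (if k = 0 then 1 else if k = 1 then -1 else 0)"
    by (auto simp: binomial_eq_0)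
  finally show ?thesis .
qed

text \<open>Expanding one factor turns \<open>x ^ j\<close> into the powers
  \<open>x ^ (n + j)\<close>. This trailing power makes M enter once instead of once per factor, so
  the spectral radius of the series is at most the absolute series at \<rho>.\<close>

lemma norm_power_series_power:
  fixes x :: "'b::{real_normed_algebra_1, banach}"
  assumes "\<And>n. norm (x ^ n) \<le> M * \<rho> ^ n" "0 \<le> \<rho>" "summable (\<lambda>n. \<bar>c n\<bar> * \<rho> ^ n)"
  shows "norm ((\<Sum>n. c n *\<^sub>R x ^ n) ^ m * x ^ j) \<le> M * \<rho> ^ j * (\<Sum>n. \<bar>c n\<bar> * \<rho> ^ n) ^ m"
proof (induction m arbitrary: j)
  case 0
  show ?case using assms(1) by simp
next
  case (Suc m)
  define f \<sigma> where "f = (\<Sum>n. c n *\<^sub>R x ^ n)" and "\<sigma> = (\<Sum>n. \<bar>c n\<bar> * \<rho> ^ n)"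
  have sm: "summable (\<lambda>n. c n *\<^sub>R x ^ n)"
  proof (rule summable_comparison_test[OF _ summable_mult[OF assms(3), of M]], intro exI allI impI)
    fix n
    have "\<bar>c n\<bar> * norm (x ^ n) \<le> \<bar>c n\<bar> * (M * \<rho> ^ n)" by (intro mult_left_mono assms) simp
    then show "norm (c n *\<^sub>R x ^ n) \<le> M * (\<bar>c n\<bar> * \<rho> ^ n)" by (simp add: mult_ac)
  qed
  have "f ^ Suc m * x ^ j = (\<Sum>n. f ^ m * (c n *\<^sub>R x ^ n) * x ^ j)"
    unfolding power_Suc2 suminf_mult2[OF summable_mult[OF sm], symmetric] suminf_mult[OF sm]
    by (simp add: f_def)
  also have "\<dots> = (\<Sum>n. c n *\<^sub>R (f ^ m * x ^ (n + j)))"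
    by (simp add: power_add mult.assoc)
  also have "norm \<dots> \<le> (\<Sum>n. (M * \<rho> ^ j * \<sigma> ^ m) * (\<bar>c n\<bar> * \<rho> ^ n))"
  proof (rule norm_suminf_le)
    fix n
    have "\<bar>c n\<bar> * norm (f ^ m * x ^ (n + j)) \<le> \<bar>c n\<bar> * (M * \<rho> ^ (n + j) * \<sigma> ^ m)"
      unfolding f_def \<sigma>_def by (intro mult_left_mono Suc) simp
    then show "norm (c n *\<^sub>R (f ^ m * x ^ (n + j))) \<le> (M * \<rho> ^ j * \<sigma> ^ m) * (\<bar>c n\<bar> * \<rho> ^ n)"
      by (simp add: mult_ac power_add)
  qed (intro summable_mult assms)
  also have "\<dots> = M * \<rho> ^ j * \<sigma> ^ Suc m"
    unfolding suminf_mult[OF assms(3)] by (simp add: \<sigma>_def)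
  finally show ?case unfolding f_def \<sigma>_def .
qed

text \<open>\<open>1 - b = x * w\<close> keeps \<open>1 - b\<close> in every ideal containing x;
  contraction of \<open>1 - b\<close> and commutation with the commutant of x are what uniqueness of
  the root will rest on.\<close>

lemma binomial_square_root:
  fixes x :: "'b::{real_normed_algebra_1, banach}"
  assumes "power_contracting x"
  obtains b w where "b * b = 1 - x" "1 - b = x * w" "power_contracting (1 - b)"
    "\<And>y. y * x = x * y \<Longrightarrow> y * b = b * y"
proof -
  obtain M \<rho> where M: "0 < M" and \<rho>: "0 < \<rho>" "\<rho> < 1" and bd: "\<And>n. norm (x ^ n) \<le> M * \<rho> ^ n"
    using power_contracting_geometric[OF assms] by blast
  define t where "t n = sqrt_coeff n *\<^sub>R x ^ n" for n
  have abs: "summable (\<lambda>n. \<bar>sqrt_coeff n\<bar> * \<rho> ^ n)" using summable_abs_sqrt_coeff \<rho> by simp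
  have smn: "summable (\<lambda>n. norm (t n))"
  proof (rule summable_comparison_test[OF _ summable_mult[OF abs, of M]], intro exI allI impI)
    fix n
    have "\<bar>sqrt_coeff n\<bar> * norm (x ^ n) \<le> \<bar>sqrt_coeff n\<bar> * (M * \<rho> ^ n)"
      by (intro mult_left_mono bd) simp
    then show "norm (norm (t n)) \<le> M * (\<bar>sqrt_coeff n\<bar> * \<rho> ^ n)" by (simp add: t_def mult_ac)
  qed
  then have sm: "summable t" by (rule summable_norm_cancel)
  define b where "b = (\<Sum>n. t n)"
  have bb: "b * b = 1 - x"
  proof -
    have "b * b = (\<Sum>k. \<Sum>i\<le>k. t i * t (k - i))"
      unfolding b_def by (rule Cauchy_product[OF smn smn])
    also have "(\<lambda>k. \<Sum>i\<le>k. t i * t (k - i))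
        = (\<lambda>k. (\<Sum>i\<le>k. sqrt_coeff i * sqrt_coeff (k - i)) *\<^sub>R x ^ k)"
      unfolding scaleR_sum_left t_def by (intro ext sum.cong) (auto simp flip: power_add)
    also have "(\<Sum>k. (\<Sum>i\<le>k. sqrt_coeff i * sqrt_coeff (k - i)) *\<^sub>R x ^ k) = 1 - x"
      unfolding sqrt_coeff_convolution by (subst suminf_finite[of "{0,1}"]) auto
    finally show ?thesis .
  qed
  \<comment> \<open>The series of \<open>1 - b\<close> with one factor x removed.\<close>
  define u where "u n = - sqrt_coeff (Suc n) *\<^sub>R x ^ n" for n
  have smu: "summable u"
  proof (rule summable_comparison_test)
    have "norm (u n) \<le> (M / \<rho>) * (\<bar>sqrt_coeff (Suc n)\<bar> * \<rho> ^ Suc n)" for n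
    proof -
      have "norm (u n) \<le> \<bar>sqrt_coeff (Suc n)\<bar> * (M * \<rho> ^ n)"
        unfolding u_def norm_scaleR abs_minus_cancel by (intro mult_left_mono bd) simp
      then show ?thesis using \<rho> by (simp add: field_simps)
    qed
    then show "\<exists>N. \<forall>n\<ge>N. norm (u n) \<le> (M / \<rho>) * (\<bar>sqrt_coeff (Suc n)\<bar> * \<rho> ^ Suc n)" by blast
    show "summable (\<lambda>n. (M / \<rho>) * (\<bar>sqrt_coeff (Suc n)\<bar> * \<rho> ^ Suc n))"
      using abs by (intro summable_mult) (simp only: summable_Suc_iff[of "\<lambda>n. \<bar>sqrt_coeff n\<bar> * \<rho> ^ n"])
  qed
  have split: "1 - b = (\<Sum>n. - t (Suc n))"
  proof -
    have "(\<Sum>n. t (Suc n)) = b - 1" unfolding b_def suminf_split_head[OF sm] by (simp add: t_def)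
    moreover have "summable (\<lambda>n. t (Suc n))" using sm by (simp only: summable_Suc_iff)
    ultimately show ?thesis by (simp only: suminf_minus minus_diff_eq)
  qed
  have "(\<Sum>n. - t (Suc n)) = x * (\<Sum>n. u n)"
    unfolding suminf_mult[OF smu, symmetric] by (simp add: t_def u_def)
  then have 1: "1 - b = x * (\<Sum>n. u n)" using split by simp
  define c where "c n = (if n = 0 then 0 else - sqrt_coeff n)" for n
  have absc: "summable (\<lambda>n. \<bar>c n\<bar> * \<rho> ^ n)"
    by (rule summable_comparison_test[OF _ abs]) (use \<rho> in \<open>auto simp: c_def\<close>)
  have "(\<lambda>n. \<bar>c n\<bar> * \<rho> ^ n) = (\<lambda>n. (if n = 0 then 1 else 0) - sqrt_coeff n * \<rho> ^ n)"
  proof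
    fix n
    show "\<bar>c n\<bar> * \<rho> ^ n = (if n = 0 then 1 else 0) - sqrt_coeff n * \<rho> ^ n"
      using sqrt_coeff_nonpos by (cases n) (auto simp: c_def abs_of_nonpos)
  qed
  moreover have "(\<lambda>n::nat. if n = 0 then 1 else (0::real)) sums 1"
    using sums_single[of 0 "\<lambda>_. 1::real"] by (simp add: eq_commute)
  ultimately have "(\<lambda>n. \<bar>c n\<bar> * \<rho> ^ n) sums (1 - sqrt (1 - \<rho>))"
    using sums_diff[OF _ sqrt_coeff_sums[of \<rho>]] \<rho> by auto
  then have \<sigma>: "(\<Sum>n. \<bar>c n\<bar> * \<rho> ^ n) = 1 - sqrt (1 - \<rho>)" by (rule sums_unique[symmetric])
  have cx: "(\<Sum>n. c n *\<^sub>R x ^ n) = 1 - b"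
  proof -
    have "(\<lambda>n. c n *\<^sub>R x ^ n) = (\<lambda>n. (if n = 0 then 1 else 0) - t n)"
      by (auto simp: c_def t_def)
    moreover have "(\<lambda>n::nat. if n = 0 then 1 else (0::'b)) sums 1"
      using sums_single[of 0 "\<lambda>_. 1::'b"] by (simp add: eq_commute)
    ultimately have "(\<lambda>n. c n *\<^sub>R x ^ n) sums (1 - b)"
      using sums_diff[OF _ summable_sums[OF sm]] unfolding b_def by auto
    then show ?thesis by (rule sums_unique[symmetric])
  qed
  have "norm ((1 - b) ^ m) \<le> M * (1 - sqrt (1 - \<rho>)) ^ m" for m
    using norm_power_series_power[OF bd _ absc, of m 0] \<rho> unfolding \<sigma> cx by simp
  then have 2: "power_contracting (1 - b)"
    by (rule power_contractingI_geometric) (use \<rho> in auto)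
  have 3: "y * b = b * y" if "y * x = x * y" for y
  proof -
    have "y * x ^ n = x ^ n * y" for n
      using that by (metis power_commuting_commutes)
    then show ?thesis
      unfolding b_def suminf_mult[OF sm, symmetric] suminf_mult2[OF sm] by (simp add: t_def)
  qed
  show ?thesis by (rule that[OF bb 1 2 3])
qed

section \<open>Hermitian ideals and Ptak's inequality\<close>

locale star_ideal = complex_ideal I sc
  for I :: "'b::{real_normed_algebra_1, banach} set" and sc +
  fixes st :: "'b \<Rightarrow> 'b"
  assumes st_add: "st (u + v) = st u + st v"
    and st_scaleR: "st (r *\<^sub>R u) = r *\<^sub>R st u"
    and st_mult: "st (u * v) = st v * st u"
    and st_st [simp]: "st (st u) = u"
    and st_in_I: "x \<in> I \<Longrightarrow> st x \<in> I"
    and st_sc: "x \<in> I \<Longrightarrow> st (sc z x) = sc (cnj z) (st x)"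
begin

lemma st_one [simp]: "st 1 = 1"
  by (metis mult_1_left mult_1_right st_mult st_st)

lemma st_minus: "st (- u) = - st u"
  using st_scaleR[of "-1" u] by simp

lemma st_diff: "st (u - v) = st u - st v"
  using st_add[of u "- v"] by (simp add: st_minus)

lemma st_power: "st (u ^ n) = st u ^ n"
  by (induction n) (simp_all add: st_mult power_commutes)

lemmas st_simps = st_add st_diff st_minus st_scaleR st_mult st_power

lemma invertible_elt_st: "invertible_elt u \<Longrightarrow> invertible_elt (st u)"
  unfolding invertible_elt_def by (metis st_mult st_one)

lemma power_contracting_sc:
  assumes x: "x \<in> I" and pc: "power_contracting x" and z: "cmod z \<le> 1"
  shows "power_contracting (sc z x)"
proof -
  obtain n where n: "n > 0" "norm (x ^ n) < 1" using pc unfolding power_contracting_def by blast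
  have "norm (sc z x ^ n) = cmod z ^ n * norm (x ^ n)"
    using x n by (simp add: power_sc norm_sc I_power norm_power)
  also have "\<dots> \<le> 1 * norm (x ^ n)"
    by (intro mult_right_mono power_le_one z) auto
  finally show ?thesis using n unfolding power_contracting_def by force
qed

text \<open>The involution need not be continuous, so this goes through the resolvent.\<close>

lemma power_contracting_st:
  assumes x: "x \<in> I" and pc: "power_contracting x"
  shows "power_contracting (st x)"
proof (rule power_contracting_of_resolvent_on_disc)
  show "st x \<in> I" by (rule st_in_I[OF x])
  fix z assume "cmod z \<le> 1"
  then have "invertible_elt (1 - sc (cnj z) x)"
    using power_contracting_sc[OF x pc] by (intro power_contracting_invertible) simp
  then have "invertible_elt (st (1 - sc (cnj z) x))" by (rule invertible_elt_st)
  then show "invertible_elt (1 - sc z (st x))" by (simp add: st_simps st_sc x)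
qed

text \<open>Ford's lemma. For \<open>d = st b\<close>, x = 1 - d^2 is a polynomial in d, so d
  commutes with x and hence with b. Since \<open>1 - b\<close> and \<open>1 - d\<close> are both
  contracting, (b + d)/2 is 1 minus a contracting average and so invertible, and (b - d)(b + d) = 0
  forces b = d.\<close>

lemma hermitian_square_root:
  assumes x: "x \<in> I" "st x = x" and pc: "power_contracting x"
  obtains b where "b * b = 1 - x" "st b = b" "invertible_elt b"
proof -
  obtain b w where b: "b * b = 1 - x" "1 - b = x * w" "power_contracting (1 - b)"
    and comm: "\<And>y. y * x = x * y \<Longrightarrow> y * b = b * y"
    using binomial_square_root[OF pc] by blast
  define d where "d = st b"
  have "st (b * b) = 1 - x" unfolding b(1) by (simp add: st_simps x)
  then have dd: "d * d = 1 - x" by (simp add: d_def st_mult)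
  have "x = 1 - d * d" using dd by simp
  moreover have "d * (1 - d * d) = (1 - d * d) * d" by (simp add: algebra_simps)
  ultimately have "d * x = x * d" by (simp only:)
  then have db: "d * b = b * d" by (rule comm)
  have bI: "1 - b \<in> I" unfolding b(2) by (rule I_mult_right[OF x(1)])
  have "power_contracting (1 - d)"
    using power_contracting_st[OF bI b(3)] by (simp add: d_def st_simps)
  moreover have "(1 - b) * (1 - d) = (1 - d) * (1 - b)" by (simp add: algebra_simps db)
  ultimately have "power_contracting (((1 - b) + (1 - d)) /\<^sub>R 2)"
    by (rule power_contracting_commuting_average[OF b(3)])
  then have "invertible_elt (1 - ((1 - b) + (1 - d)) /\<^sub>R 2)" by (rule power_contracting_invertible)
  also have "1 - ((1 - b) + (1 - d)) /\<^sub>R 2 = (b + d) /\<^sub>R 2"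
  proof -
    have "(1 - b) + (1 - d) = 2 *\<^sub>R 1 - (b + d)" by (simp add: scaleR_2)
    then have "((1 - b) + (1 - d)) /\<^sub>R 2 = 2 *\<^sub>R 1 /\<^sub>R 2 - (b + d) /\<^sub>R 2"
      by (simp only: scaleR_diff_right)
    moreover have "2 *\<^sub>R 1 /\<^sub>R 2 = (1::'b)" by simp
    ultimately show ?thesis by (simp only: diff_diff_eq2 add_diff_cancel_left')
  qed
  finally obtain v where v: "(b + d) /\<^sub>R 2 * v = 1" unfolding invertible_elt_def by blast
  have "b * b - b * d + (d * b - d * d) = 0" unfolding b(1) dd db by simp
  then have "(b - d) * (b + d) = 0" unfolding db by (simp add: algebra_simps b(1) dd db)
  then have "(b - d) * ((b + d) /\<^sub>R 2 * v) = 0" by (simp flip: mult.assoc)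
  then have "b - d = 0" by (simp only: v mult_1_right)
  moreover have "invertible_elt b"
    using power_contracting_invertible[OF pc] unfolding b(1)[symmetric]
    by (rule invertible_elt_commuting_factor) simp
  ultimately show ?thesis using that b(1) by (simp add: d_def)
qed

end

locale hermitian_ideal = star_ideal +
  assumes herm: "x \<in> I \<Longrightarrow> st x = x \<Longrightarrow> Im z \<noteq> 0 \<Longrightarrow> invertible_elt (1 - sc z x)"
begin

text \<open>With b^2 = 1 - a*a, the product (1 + a*)(1 - a) equals b(1 + k)b, where
  k = b^(-1)(a* - a)b^(-1) is skew-Hermitian.\<close>

lemma invertible_one_plus_star_times_one_minus:
  assumes a: "a \<in> I" and pc: "power_contracting (st a * a)"
  shows "invertible_elt ((1 + st a) * (1 - a))"
proof -
  have "st a * a \<in> I" "st (st a * a) = st a * a"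
    using a by (simp_all add: I_intros st_simps)
  then obtain b where b: "b * b = 1 - st a * a" "st b = b" "invertible_elt b"
    using hermitian_square_root pc by blast
  define c where "c = rinv b"
  have c: "b * c = 1" "c * b = 1" using rinv[OF b(3)] by (simp_all add: c_def)
  have "st c * b = 1" "b * st c = 1" using c b(2) by (metis st_mult st_one)+
  then have stc: "st c = c" using c(1) left_right_inverse_eq by blast
  define k where "k = c * (st a - a) * c"
  have kI: "k \<in> I" unfolding k_def using a by (intro I_mult_right I_mult_left I_diff st_in_I)
  have "st k = - k" by (simp add: k_def st_simps stc algebra_simps)
  \<comment> \<open>k is skew, so \<i> k is Hermitian, and 1 + k = 1 - \<i> (\<i> k) has the
    non-real parameter \<i>.\<close>
  then have "st (sc \<i> k) = sc \<i> k"
    using kI by (simp add: st_sc sc_minus_left sc_minus_right I_minus)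
  then have "invertible_elt (1 - sc \<i> (sc \<i> k))"
    using kI by (intro herm sc_in_I) auto
  then have ik: "invertible_elt (1 + k)" using kI by (simp add: sc_sc sc_minus_left)
  have "b * (1 + k) * b = b * b + (b * c) * (st a - a) * (c * b)"
    by (simp add: k_def algebra_simps)
  also have "\<dots> = (1 + st a) * (1 - a)" unfolding c b(1) by (simp add: algebra_simps)
  finally show ?thesis using invertible_elt_mult[OF invertible_elt_mult[OF b(3) ik] b(3)] by simp
qed

text \<open>The preceding product yields a left inverse of \<open>1 - a\<close>. A right inverse
  comes from the same product for \<open>- st a\<close>, which is
  \<open>(1 - a) * (1 + st a)\<close>; its hypothesis holds by cyclic permutation.\<close>

lemma invertible_one_minus_of_star_contracting:
  assumes a: "a \<in> I" and pc: "power_contracting (st a * a)"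
  shows "invertible_elt (1 - a)"
proof -
  obtain v where v: "v * ((1 + st a) * (1 - a)) = 1"
    using invertible_one_plus_star_times_one_minus[OF assms] unfolding invertible_elt_def by blast
  have "power_contracting (a * st a)" by (rule power_contracting_swap[OF pc])
  then obtain w where w: "((1 - a) * (1 + st a)) * w = 1"
    using invertible_one_plus_star_times_one_minus[of "- st a"] a
    unfolding invertible_elt_def by (auto simp: st_simps I_minus st_in_I)
  show ?thesis
    using v w by (intro invertible_elt_left_right[of "v * (1 + st a)" _ "(1 + st a) * w"])
      (simp_all add: mult.assoc)
qed

text \<open>A form of r(a)^2 \<le> r(\<open>st a * a\<close>). Multiplying a by z multiplies
  \<open>st a * a\<close> by |z|^2, so the disc criterion reduces the claim to invertibility of
  \<open>1 - a\<close>.\<close>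

theorem Ptak_inequality:
  assumes a: "a \<in> I" and pc: "power_contracting (st a * a)"
  shows "power_contracting a"
proof (rule power_contracting_of_resolvent_on_disc[OF a])
  fix z assume z: "cmod z \<le> 1"
  have "st (sc z a) * sc z a = sc (cnj z * z) (st a * a)"
    using a by (simp add: st_sc sc_mult_sc st_in_I)
  moreover have "cmod (cnj z * z) \<le> 1" using z by (simp add: norm_mult mult_le_one)
  ultimately have "power_contracting (st (sc z a) * sc z a)"
    using power_contracting_sc[OF _ pc] a by (simp add: I_mult_left)
  then show "invertible_elt (1 - sc z a)"
    by (intro invertible_one_minus_of_star_contracting sc_in_I a)
qed

text \<open>By Ptak, r(f g)^2 \<le> r(g f f g) = r(f^2 g^2) for Hermitian f and g, the equality by
  cyclic permutation; each induction step squares both factors.\<close>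

lemma power_contracting_mult_of_powers:
  assumes "f \<in> I" "st f = f" "g \<in> I" "st g = g"
    and "power_contracting (f ^ 2 ^ m * g ^ 2 ^ m)"
  shows "power_contracting (f * g)"
  using assms
proof (induction m arbitrary: f g)
  case (Suc m)
  have "power_contracting (f\<^sup>2 * g\<^sup>2)"
  proof (rule Suc.IH)
    show "power_contracting ((f\<^sup>2) ^ 2 ^ m * (g\<^sup>2) ^ 2 ^ m)"
      using Suc.prems(5) by (simp add: power_mult[symmetric])
  qed (use Suc.prems in \<open>auto simp: st_simps power2_eq_square I_mult_left\<close>)
  then have "power_contracting ((f * f * g) * g)" by (simp add: power2_eq_square mult.assoc)
  then have "power_contracting (g * (f * f * g))" by (rule power_contracting_swap)
  then have "power_contracting (st (f * g) * (f * g))"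
    using Suc.prems by (simp add: st_mult mult.assoc)
  then show ?case by (rule Ptak_inequality[OF I_mult_left[OF Suc.prems(3)]])
qed simp

text \<open>f and g need not commute: their high powers are separately small, and the preceding
  lemma descends from the product of the powers.\<close>

theorem power_contracting_hermitian_mult:
  assumes "f \<in> I" "st f = f" "g \<in> I" "st g = g"
    and "power_contracting f" "power_contracting g"
  shows "power_contracting (f * g)"
proof -
  have "(\<lambda>n. f ^ n * g ^ n) \<longlonglongrightarrow> 0 * 0"
    by (intro tendsto_mult power_contracting_tendsto_zero assms)
  then have "(\<lambda>n. f ^ 2 ^ n * g ^ 2 ^ n) \<longlonglongrightarrow> 0"
    using LIMSEQ_subseq_LIMSEQ[of "\<lambda>n. f ^ n * g ^ n" 0 "\<lambda>n. 2 ^ n"] by (simp add: strict_mono_def o_def)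
  then have "\<forall>\<^sub>F n in sequentially. norm (f ^ 2 ^ n * g ^ 2 ^ n) < 1"
    using tendsto_norm_zero order_tendstoD(2)[of _ "0::real" sequentially 1] by fastforce
  then obtain m where "norm (f ^ 2 ^ m * g ^ 2 ^ m) < 1" by (auto simp: eventually_sequentially)
  then have "power_contracting (f ^ 2 ^ m * g ^ 2 ^ m)"
    unfolding power_contracting_def by (intro exI[of _ 1]) auto
  then show ?thesis using power_contracting_mult_of_powers assms by blast
qed

text \<open>If x and s are Hermitian, with spectra in (-1/2, oo) and [0, oo), then
  f = (1 + x)^(-1) x and g = s (1 + s)^(-1) have spectral radius less than 1, and
  1 + x + s = (1 + x)(1 - f g)(1 + s).\<close>

lemma power_contracting_quotient:
  assumes x: "x \<in> I" "st x = x"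
    and inv: "\<And>t. 0 \<le> t \<Longrightarrow> t \<le> 2 \<Longrightarrow> invertible_elt (1 + t *\<^sub>R x)"
    and v: "(1 + x) * v = 1" "v * (1 + x) = 1"
  shows "v * x \<in> I" "st (v * x) = v * x" "power_contracting (v * x)" "v * x = x * v"
proof -
  show vx: "v * x = x * v" by (rule inverse_commutes[OF v]) (simp add: algebra_simps)
  show I: "v * x \<in> I" by (rule I_mult_left[OF x(1)])
  have "(1 + x) * st v = st (v * (1 + x))" "st v * (1 + x) = st ((1 + x) * v)"
    by (simp_all add: st_mult st_add x)
  then have "(1 + x) * st v = 1" "st v * (1 + x) = 1" unfolding v by simp_all
  then have "st v = v" using v(1) left_right_inverse_eq by blast
  then show "st (v * x) = v * x" by (simp add: st_mult x vx)
  show "power_contracting (v * x)"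
  proof (rule power_contracting_of_resolvent_on_disc[OF I])
    fix z assume z: "cmod z \<le> 1"
    \<comment> \<open>\<open>1 - sc z (v * x)\<close> is v times this element. For real z in [-1, 1]
      the number 1 - z runs through [0, 2], the range of t in the hypothesis.\<close>
    have "invertible_elt (1 - sc (z - 1) x)"
    proof (cases "Im z = 0")
      case True
      then obtain r where r: "z = of_real r" using complex_is_Real_iff Reals_cases by metis
      then have "\<bar>r\<bar> \<le> 1" using z by simp
      then have "invertible_elt (1 + (1 - r) *\<^sub>R x)" by (intro inv) auto
      also have "1 + (1 - r) *\<^sub>R x = 1 - sc (of_real (r - 1)) x"
        using x by (simp only: sc_of_real) (simp add: algebra_simps)
      finally show ?thesis by (simp add: r)
    next
      case False
      then show ?thesis using x by (intro herm) auto
    qed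
    moreover have "1 - sc z (v * x) = v * (1 - sc (z - 1) x)"
    proof -
      have "v * (1 - sc (z - 1) x) = v * (1 + x) - v * sc z x"
        by (simp add: sc_diff_left x algebra_simps)
      then show ?thesis by (simp add: v mult_sc x)
    qed
    moreover have "invertible_elt v" using v unfolding invertible_elt_def by blast
    ultimately show "invertible_elt (1 - sc z (v * x))" by (simp add: invertible_elt_mult)
  qed
qed

lemma invertible_one_plus_sum:
  assumes x: "x \<in> I" "st x = x" and s: "s \<in> I" "st s = s"
    and invx: "\<And>t. 0 \<le> t \<Longrightarrow> t \<le> 2 \<Longrightarrow> invertible_elt (1 + t *\<^sub>R x)"
    and invs: "\<And>t. 0 \<le> t \<Longrightarrow> invertible_elt (1 + t *\<^sub>R s)"
  shows "invertible_elt (1 + (x + s))"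
proof -
  have ix: "invertible_elt (1 + x)" and js: "invertible_elt (1 + s)"
    using invx[of 1] invs[of 1] by simp_all
  define v w where "v = rinv (1 + x)" and "w = rinv (1 + s)"
  have v: "(1 + x) * v = 1" "v * (1 + x) = 1" and w: "(1 + s) * w = 1" "w * (1 + s) = 1"
    using rinv ix js by (simp_all add: v_def w_def)
  have f: "v * x \<in> I" "st (v * x) = v * x" "power_contracting (v * x)"
    by (rule power_contracting_quotient[OF x _ v], rule invx, assumption+)+
  have g: "w * s \<in> I" "st (w * s) = w * s" "power_contracting (w * s)" "w * s = s * w"
    by (rule power_contracting_quotient[OF s _ w], rule invs, assumption+)+
  have "power_contracting ((v * x) * (w * s))"
    by (intro power_contracting_hermitian_mult f g)
  then have "invertible_elt (1 - (v * x) * (w * s))" by (rule power_contracting_invertible)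
  moreover have "(1 + x) * (1 - (v * x) * (w * s)) * (1 + s) = 1 + (x + s)"
  proof -
    have "(1 + x) * ((v * x) * (w * s)) = ((1 + x) * v) * (x * (w * s))" by (simp only: mult.assoc)
    also have "\<dots> = x * s * w" unfolding v g(4) by (simp only: mult_1_left mult.assoc)
    finally have eq: "(1 + x) * ((v * x) * (w * s)) = x * s * w" .
    have "(1 + x) * (1 - (v * x) * (w * s)) * (1 + s) = (1 + x) * (1 + s) - x * s * w * (1 + s)"
      by (simp only: right_diff_distrib left_diff_distrib eq mult_1_right)
    also have "x * s * w * (1 + s) = x * s" by (simp only: mult.assoc w mult_1_right)
    finally show ?thesis by (simp add: distrib_left distrib_right)
  qed
  ultimately show ?thesis
    using invertible_elt_mult[OF invertible_elt_mult[OF ix] js] by metis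
qed

text \<open>1 + t h^2 = (1 - y)(1 + y) with y = \<i> sqrt(t) h; for t > 0 both factors have a
  non-real parameter.\<close>

lemma invertible_one_plus_hermitian_square:
  assumes h: "h \<in> I" "st h = h" and t: "0 \<le> t"
  shows "invertible_elt (1 + t *\<^sub>R (h * h))"
proof (cases "t = 0")
  case False
  define y where "y = sc (\<i> * sqrt t) h"
  have "invertible_elt (1 - sc (\<i> * sqrt t) h)" "invertible_elt (1 - sc (- (\<i> * sqrt t)) h)"
    using t False by (auto intro!: herm h)
  then have "invertible_elt ((1 - y) * (1 + y))"
    by (intro invertible_elt_mult) (simp_all add: y_def sc_minus_left h)
  moreover have "y * y = sc (of_real (- t)) (h * h)"
  proof -
    have "complex_of_real (sqrt t) * sqrt t = t"
      unfolding of_real_mult[symmetric] using t by simp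
    then have "(\<i> * sqrt t) * (\<i> * sqrt t) = of_real (- t)"
      by (simp add: complex_eq_iff)
    then show ?thesis unfolding y_def by (simp only: sc_mult_sc h)
  qed
  then have "y * y = - t *\<^sub>R (h * h)" by (simp only: sc_of_real h I_mult_left)
  then have "(1 - y) * (1 + y) = 1 + t *\<^sub>R (h * h)" by (simp add: algebra_simps)
  ultimately show ?thesis by simp
qed simp

text \<open>Write a*a as (-aa*) + (a*a + aa*): the spectrum of the first summand lies above -1/2, and the
  second one is a sum of squares of Hermitian elements.\<close>

lemma invertible_one_plus_star_of_bounded:
  assumes a: "a \<in> I"
    and inv: "\<And>t. 0 \<le> t \<Longrightarrow> t \<le> 2 \<Longrightarrow> invertible_elt (1 - t *\<^sub>R (st a * a))"
  shows "invertible_elt (1 + st a * a)"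
proof -
  define h k where "h = a + st a" and "k = sc \<i> (a - st a)"
  have h: "h \<in> I" "st h = h" and k: "k \<in> I" "st k = k"
    using a by (auto simp: h_def k_def I_intros st_in_I st_simps st_sc add.commute sc_minus_left sc_diff_right)
  define p q where "p = (1/2) *\<^sub>R (h * h)" and "q = (1/2) *\<^sub>R (k * k)"
  have pq: "p \<in> I" "st p = p" "q \<in> I" "st q = q"
    using h k by (simp_all add: p_def q_def I_intros st_simps)
  have p: "invertible_elt (1 + t *\<^sub>R p)" if "0 \<le> t" for t
    using invertible_one_plus_hermitian_square[OF h, of "t/2"] that by (simp add: p_def)
  have q: "invertible_elt (1 + t *\<^sub>R q)" if "0 \<le> t" for t
    using invertible_one_plus_hermitian_square[OF k, of "t/2"] that by (simp add: q_def)
  have s: "invertible_elt (1 + t *\<^sub>R (p + q))" if t: "0 \<le> t" for t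
    unfolding scaleR_add_right
    by (rule invertible_one_plus_sum) (use pq p q t in \<open>auto simp: I_scaleR st_scaleR\<close>)
  have kk: "k * k = - ((a - st a) * (a - st a))"
    using a by (simp add: k_def sc_mult_sc I_diff st_in_I sc_minus_left I_mult_left)
  have "h * h + k * k = 2 *\<^sub>R (st a * a + a * st a)"
    unfolding kk h_def by (simp add: algebra_simps scaleR_2)
  then have pq_eq: "p + q = st a * a + a * st a"
    unfolding p_def q_def by (simp flip: scaleR_add_right)
  \<comment> \<open>Exchanging the factors carries the hypothesis from \<open>st a * a\<close> to
    \<open>a * st a\<close>.\<close>
  have x: "invertible_elt (1 + t *\<^sub>R (- (a * st a)))" if "0 \<le> t" "t \<le> 2" for t
    using invertible_elt_one_minus_swap[of "t *\<^sub>R st a" a] inv[OF that] by simp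
  have "invertible_elt (1 + (- (a * st a) + (p + q)))"
    by (rule invertible_one_plus_sum)
       (use pq s x a in \<open>auto simp: I_minus I_add I_mult_right st_simps\<close>)
  then show ?thesis unfolding pq_eq by simp
qed

end

section \<open>The cubic transformation and the Shirali--Ford theorem\<close>

lemma cubic_vieta:
  fixes u v y :: complex
  obtains z1 z2 z3 where "u = z1 + z2 + z3" "v = z1 * z2 + z1 * z3 + z2 * z3" "y = z1 * z2 * z3"
proof -
  have "\<not> constant (poly [:-y, v, -u, 1:])"
  proof
    define f where "f = poly [:-y, v, -u, 1:]"
    assume "constant (poly [:-y, v, -u, 1:])"
    then have "f 1 = f 0" "f 2 = f 0" "f (-1) = f 0"
      unfolding constant_def f_def[symmetric] by blast+
    \<comment> \<open>The third difference of a monic cubic is 3! = 6, that of a constant is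
      0.\<close>
    moreover have "f 2 - 3 * f 1 + 3 * f 0 - f (-1) = 6" by (simp add: f_def algebra_simps)
    ultimately show False by simp
  qed
  then obtain z1 where "poly [:-y, v, -u, 1:] z1 = 0"
    using fundamental_theorem_of_algebra by blast
  then have z1: "y = z1 * (v - z1 * (u - z1))" by (simp add: algebra_simps)
  define S P where "S = u - z1" and "P = v - z1 * S"
  define D where "D = csqrt (S\<^sup>2 - 4 * P)"
  have D: "D\<^sup>2 = S\<^sup>2 - 4 * P" by (simp add: D_def)
  define z2 z3 where "z2 = (S + D) / 2" and "z3 = (S - D) / 2"
  have sum: "z2 + z3 = S" by (simp add: z2_def z3_def field_simps)
  have "z2 * z3 = (S\<^sup>2 - D\<^sup>2) / 4" by (simp add: z2_def z3_def field_simps power2_eq_square)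
  then have prod: "z2 * z3 = P" unfolding D by simp
  have "u = z1 + (z2 + z3)" unfolding sum S_def by simp
  moreover have "v = z1 * (z2 + z3) + z2 * z3" unfolding sum prod P_def by simp
  moreover have "y = z1 * (z2 * z3)" unfolding prod P_def S_def by (rule z1)
  ultimately show ?thesis by (intro that) (simp_all add: algebra_simps)
qed

text \<open>With r = 1/x this is p(x) \<le> 1 on (0, 1]. The difference of the sides has the factor
  r - 1, and \<alpha> \<ge> 2 enters through \<alpha>(\<alpha> - 2).\<close>

lemma positive_root_bound:
  fixes \<alpha> r :: real
  assumes "\<alpha> \<ge> 2" "r \<ge> 1"
  shows "((\<alpha> + 1) * r - 1)\<^sup>2 \<le> \<alpha>\<^sup>2 * r ^ 3"
proof -
  have "\<alpha>\<^sup>2 * r ^ 3 - ((\<alpha> + 1) * r - 1)\<^sup>2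
      = (r - 1) * ((r - 1) * (\<alpha>\<^sup>2 * r - 1) + (\<alpha> * (\<alpha> - 2)) * r)"
    by (simp add: power2_eq_square power3_eq_cube algebra_simps)
  moreover have "1 * 1 \<le> \<alpha>\<^sup>2 * r" using assms by (intro mult_mono one_le_power) auto
  ultimately have "\<alpha>\<^sup>2 * r ^ 3 - ((\<alpha> + 1) * r - 1)\<^sup>2 \<ge> 0" using assms by simp
  then show ?thesis by simp
qed

text \<open>For w \<noteq> 0 the equation says 1/w = p(1/r); r \<ge> 1 would put 1/r into (0, 1],
  where p is at most 1, so |w| \<ge> 1.\<close>

lemma real_root_less_one:
  fixes \<alpha> r :: real
  assumes \<alpha>: "\<alpha> \<ge> 2" and w: "cmod w < 1"
    and root: "complex_of_real r ^ 3 = w / of_real (\<alpha>\<^sup>2) * (of_real (\<alpha> + 1) * of_real r - 1)\<^sup>2"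
  shows "r < 1"
proof (rule ccontr)
  assume "\<not> r < 1"
  then have r: "r \<ge> 1" by simp
  define B where "B = (\<alpha> + 1) * r - 1"
  have "1 * 1 \<le> \<alpha> * r" using \<alpha> r by (intro mult_mono) auto
  then have B: "B > 0" using \<alpha> r by (simp add: B_def algebra_simps)
  have "complex_of_real (\<alpha>\<^sup>2 * r ^ 3) = w * of_real (B\<^sup>2)"
    using root \<alpha> by (simp add: B_def field_simps)
  then have "norm (complex_of_real (\<alpha>\<^sup>2 * r ^ 3)) = norm (w * of_real (B\<^sup>2))" by simp
  then have "\<alpha>\<^sup>2 * r ^ 3 = cmod w * B\<^sup>2"
    unfolding norm_mult norm_of_real using r by (simp add: abs_mult)
  also have "\<dots> < B\<^sup>2" using w B by simp
  finally show False using positive_root_bound[OF \<alpha> r] by (simp add: B_def)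
qed

section \<open>Spectral mapping for cubic polynomials\<close>

context complex_ideal
begin

lemma quadratic_factor:
  assumes b: "b \<in> I"
  shows "(1 - sc z1 b) * (1 - sc z2 b) = 1 - sc (z1 + z2) b + sc (z1 * z2) (b * b)"
  using b by (simp add: algebra_simps sc_mult_sc sc_add_left)

lemma cubic_factor:
  assumes b: "b \<in> I"
  shows "(1 - sc z1 b) * ((1 - sc z2 b) * (1 - sc z3 b)) = 1 - sc (z1 + z2 + z3) b
    + sc (z1 * z2 + z1 * z3 + z2 * z3) (b * b) - sc (z1 * z2 * z3) (b * b * b)"
  using b by (simp add: algebra_simps sc_mult_sc sc_add_left I_mult_left I_mult_right)

text \<open>The cubic in b is the product of the three factors \<open>1 - sc z b\<close> over the
  roots z of the reciprocal polynomial, with multiplicity.\<close>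

lemma invertible_cubic:
  assumes b: "b \<in> I"
    and inv: "\<And>z. z ^ 3 - u * z\<^sup>2 + v * z - y = 0 \<Longrightarrow> invertible_elt (1 - sc z b)"
  shows "invertible_elt (1 - sc u b + sc v (b * b) - sc y (b * b * b))"
proof -
  obtain z1 z2 z3 where z: "u = z1 + z2 + z3" "v = z1 * z2 + z1 * z3 + z2 * z3" "y = z1 * z2 * z3"
    using cubic_vieta by blast
  have "z ^ 3 - u * z\<^sup>2 + v * z - y = (z - z1) * ((z - z2) * (z - z3))" for z
    unfolding z by (simp add: power2_eq_square power3_eq_cube algebra_simps)
  then have "invertible_elt (1 - sc z1 b)" "invertible_elt (1 - sc z2 b)" "invertible_elt (1 - sc z3 b)"
    using inv by simp_all
  then have "invertible_elt ((1 - sc z1 b) * ((1 - sc z2 b) * (1 - sc z3 b)))"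
    by (intro invertible_elt_mult)
  then show ?thesis unfolding cubic_factor[OF b] z .
qed

lemma invertible_of_cubic:
  assumes b: "b \<in> I" and inv: "invertible_elt (1 - sc u b + sc v (b * b) - sc y (b * b * b))"
    and root: "z ^ 3 - u * z\<^sup>2 + v * z - y = 0"
  shows "invertible_elt (1 - sc z b)"
proof -
  \<comment> \<open>Cofactor of \<open>1 - sc z b\<close>, from synthetic division by the root z; as
    a polynomial in b it commutes with that factor.\<close>
  define q where "q = 1 - sc (u - z) b + sc (v - z * (u - z)) (b * b)"
  have y: "y = z * (v - z * (u - z))"
    using root by (simp add: power2_eq_square power3_eq_cube algebra_simps)
  have "(1 - sc z b) * q = 1 - sc u b + sc v (b * b) - sc y (b * b * b)"
    unfolding y q_def using b
    by (simp add: algebra_simps sc_mult_sc sc_add_left sc_diff_left I_mult_left I_mult_right)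
  moreover have "(1 - sc z b) * q = q * (1 - sc z b)"
    unfolding q_def using b
    by (simp add: algebra_simps sc_mult_sc sc_add_left sc_diff_left I_mult_left I_mult_right)
  ultimately show ?thesis using inv by (metis invertible_elt_commuting_factor)
qed

text \<open>|z| < 1 corresponds to spectral points 1/z outside the closed unit disc. The bound is
  non-strict, unlike \<open>power_contracting\<close>, to match
  \<open>r_sigma star a \<le> 1\<close>.\<close>

definition radius_le_one :: "'b \<Rightarrow> bool" where
  "radius_le_one x \<longleftrightarrow> (\<forall>z. cmod z < 1 \<longrightarrow> invertible_elt (1 - sc z x))"

text \<open>The open disc is exhausted by closed ones, and the closed disc of radius t for x is the
  closed unit disc for \<open>t *\<^sub>R x\<close>.\<close>

lemma radius_le_one_iff_power_contracting:
  assumes x: "x \<in> I"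
  shows "radius_le_one x \<longleftrightarrow> (\<forall>t. 0 \<le> t \<and> t < 1 \<longrightarrow> power_contracting (t *\<^sub>R x))"
proof (intro iffI allI impI)
  fix t :: real assume r: "radius_le_one x" and t: "0 \<le> t \<and> t < 1"
  show "power_contracting (t *\<^sub>R x)"
  proof (rule power_contracting_of_resolvent_on_disc)
    fix z assume "cmod z \<le> 1"
    then have "cmod (z * of_real t) < 1"
      using t mult_left_le_one_le[of t "cmod z"] by (simp add: norm_mult) 
    then have "invertible_elt (1 - sc (z * of_real t) x)" using r by (simp add: radius_le_one_def)
    then show "invertible_elt (1 - sc z (t *\<^sub>R x))"
      using x by (simp only: sc_sc[symmetric] sc_of_real)
  qed (rule I_scaleR[OF x])
next
  assume *: "\<forall>t. 0 \<le> t \<and> t < 1 \<longrightarrow> power_contracting (t *\<^sub>R x)"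
  show "radius_le_one x" unfolding radius_le_one_def
  proof (intro allI impI)
    fix z assume "cmod z < 1"
    then obtain n where n: "n > 0" "norm ((cmod z *\<^sub>R x) ^ n) < 1"
      using * unfolding power_contracting_def by (metis norm_ge_zero)
    have "norm (sc z x ^ n) = norm ((cmod z *\<^sub>R x) ^ n)"
      using n(1) x by (simp add: power_sc norm_sc I_power scaleR_power norm_power)
    then show "invertible_elt (1 - sc z x)"
      using n by (intro power_contracting_invertible) (auto simp: power_contracting_def)
  qed
qed

end

section \<open>The cubic transformation and criteria for being Hermitian\<close>

context star_ideal
begin

definition cubic_step :: "real \<Rightarrow> 'b \<Rightarrow> 'b" where
  "cubic_step \<alpha> a = inverse \<alpha> *\<^sub>R ((\<alpha> + 1) *\<^sub>R a - a * st a * a)"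

lemma cubic_step_in_I: "a \<in> I \<Longrightarrow> cubic_step \<alpha> a \<in> I"
  by (simp add: cubic_step_def I_intros)

text \<open>The transformed element is c = a(\<beta> - b)/\<alpha>, so \<open>st c * c\<close> is
  p(b); here 1 - w p(b) is expanded into the shape of \<open>invertible_cubic\<close>.\<close>

lemma star_cubic_step:
  assumes a: "a \<in> I" and \<alpha>: "\<alpha> > 0" and b: "b = st a * a"
  shows "1 - sc w (st (cubic_step \<alpha> a) * cubic_step \<alpha> a)
    = 1 - sc (w / of_real (\<alpha>\<^sup>2) * of_real ((\<alpha> + 1)\<^sup>2)) b
      + sc (w / of_real (\<alpha>\<^sup>2) * of_real (2 * (\<alpha> + 1))) (b * b)
      - sc (w / of_real (\<alpha>\<^sup>2)) (b * b * b)"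
proof -
  define \<beta> c where "\<beta> = \<alpha> + 1" and "c = cubic_step \<alpha> a"
  have bI: "b \<in> I" "b * b \<in> I" "b * b * b \<in> I" using a by (simp_all add: b I_mult_left)
  have "st c * c = (inverse \<alpha> * inverse \<alpha>) *\<^sub>R
      ((\<beta> *\<^sub>R st a - st a * a * st a) * (\<beta> *\<^sub>R a - a * st a * a))"
    by (simp add: c_def cubic_step_def st_simps \<beta>_def mult.assoc)
  also have "(\<beta> *\<^sub>R st a - st a * a * st a) * (\<beta> *\<^sub>R a - a * st a * a)
      = \<beta>\<^sup>2 *\<^sub>R b - (2 * \<beta>) *\<^sub>R (b * b) + b * b * b"
  proof -
    have "(\<beta> *\<^sub>R st a - st a * a * st a) * (\<beta> *\<^sub>R a - a * st a * a)
      = (\<beta> * \<beta>) *\<^sub>R b - (\<beta> *\<^sub>R (b * b) + \<beta> *\<^sub>R (b * b)) + b * b * b"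
      by (simp add: b algebra_simps)
    then show ?thesis by (simp add: power2_eq_square scaleR_2 flip: scaleR_scaleR)
  qed
  also have "inverse \<alpha> * inverse \<alpha> = 1 / \<alpha>\<^sup>2" by (simp add: power2_eq_square divide_inverse)
  finally have "st c * c = (1 / \<alpha>\<^sup>2) *\<^sub>R (\<beta>\<^sup>2 *\<^sub>R b - (2 * \<beta>) *\<^sub>R (b * b) + b * b * b)" .
  moreover define v where "v = \<beta>\<^sup>2 *\<^sub>R b - (2 * \<beta>) *\<^sub>R (b * b) + b * b * b"
  moreover have vI: "v \<in> I" using bI by (simp add: v_def I_intros)
  ultimately have "sc w (st c * c) = sc (w / of_real (\<alpha>\<^sup>2)) v"
    by (simp add: sc_of_real[symmetric] sc_sc divide_inverse)
  also have "\<dots> = sc (w / of_real (\<alpha>\<^sup>2)) (sc (of_real (\<beta>\<^sup>2)) b)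
      - sc (w / of_real (\<alpha>\<^sup>2)) (sc (of_real (2 * \<beta>)) (b * b))
      + sc (w / of_real (\<alpha>\<^sup>2)) (b * b * b)"
    unfolding v_def using bI by (simp only: sc_of_real sc_add_right sc_diff_right I_scaleR I_diff)
  finally show ?thesis using bI unfolding c_def \<beta>_def by (simp only: sc_sc) simp
qed

text \<open>For k = w/\<alpha>^2 and nonzero z, w, a zero of this polynomial means p(1/z) =
  1/w.\<close>

lemma cubic_step_root:
  fixes k z :: complex and \<alpha> :: real
  shows "z ^ 3 - (k * of_real ((\<alpha> + 1)\<^sup>2)) * z\<^sup>2 + (k * of_real (2 * (\<alpha> + 1))) * z - k
    = z ^ 3 - k * (of_real (\<alpha> + 1) * z - 1)\<^sup>2"
  by (simp add: power2_eq_square algebra_simps)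

lemma invertible_cubic_step:
  assumes a: "a \<in> I" and \<alpha>: "\<alpha> > 0"
    and inv: "\<And>z. z ^ 3 = w / of_real (\<alpha>\<^sup>2) * (of_real (\<alpha> + 1) * z - 1)\<^sup>2
      \<Longrightarrow> invertible_elt (1 - sc z (st a * a))"
  shows "invertible_elt (1 - sc w (st (cubic_step \<alpha> a) * cubic_step \<alpha> a))"
  unfolding star_cubic_step[OF a \<alpha> refl]
  by (rule invertible_cubic) (use a inv in \<open>simp_all only: cubic_step_root right_minus_eq I_mult_left\<close>)

lemma invertible_of_cubic_step:
  assumes a: "a \<in> I" and \<alpha>: "\<alpha> > 0"
    and inv: "invertible_elt (1 - sc w (st (cubic_step \<alpha> a) * cubic_step \<alpha> a))"
    and root: "z ^ 3 = w / of_real (\<alpha>\<^sup>2) * (of_real (\<alpha> + 1) * z - 1)\<^sup>2"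
  shows "invertible_elt (1 - sc z (st a * a))"
  using inv[unfolded star_cubic_step[OF a \<alpha> refl]]
proof (rule invertible_of_cubic[rotated])
  show "z ^ 3 - w / of_real (\<alpha>\<^sup>2) * of_real ((\<alpha> + 1)\<^sup>2) * z\<^sup>2
      + w / of_real (\<alpha>\<^sup>2) * of_real (2 * (\<alpha> + 1)) * z - w / of_real (\<alpha>\<^sup>2) = 0"
    unfolding cubic_step_root unfolding root by (rule diff_self)
qed (rule I_mult_left[OF a])

lemma st_mult_self_scaleR: "st (r *\<^sub>R a) * (r *\<^sub>R a) = r\<^sup>2 *\<^sub>R (st a * a)"
  by (simp add: st_scaleR power2_eq_square)

lemma cubic_step_negative:
  assumes a: "a \<in> I" and \<alpha>: "\<alpha> > 0" and t: "t > 0"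
    and ninv: "\<not> invertible_elt (1 + t *\<^sub>R (st a * a))"
  obtains t' where "0 < t'" "t' \<le> (\<alpha> / (\<alpha> + 1))\<^sup>2 * t"
    "\<not> invertible_elt (1 + t' *\<^sub>R (st (cubic_step \<alpha> a) * cubic_step \<alpha> a))"
proof
  define d where "d = (\<alpha> + 1) * t + 1"
  have d: "d > 0" using \<alpha> t by (simp add: d_def add_pos_pos)
  \<comment> \<open>t' solves p(-1/t) = -1/t'. Dropping the summand 1 of d in the denominator gives
    the factor (\<alpha>/(\<alpha> + 1))^2.\<close>
  define t' where "t' = \<alpha>\<^sup>2 * t ^ 3 / d\<^sup>2"
  show "0 < t'" using \<alpha> t d by (simp add: t'_def)
  have "((\<alpha> + 1) * t)\<^sup>2 \<le> d\<^sup>2" using \<alpha> t by (intro power_mono) (auto simp: d_def)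
  then have "\<alpha>\<^sup>2 * t ^ 3 / d\<^sup>2 \<le> \<alpha>\<^sup>2 * t ^ 3 / ((\<alpha> + 1) * t)\<^sup>2"
    using \<alpha> t d by (intro divide_left_mono mult_nonneg_nonneg) auto
  also have "\<dots> = (\<alpha> / (\<alpha> + 1))\<^sup>2 * t"
    using \<alpha> t by (simp add: power_divide power_mult_distrib power2_eq_square power3_eq_cube)
  finally show "t' \<le> (\<alpha> / (\<alpha> + 1))\<^sup>2 * t" by (simp add: t'_def)
  have cI: "st (cubic_step \<alpha> a) * cubic_step \<alpha> a \<in> I" by (intro I_mult_left cubic_step_in_I a)
  have aI: "st a * a \<in> I" by (intro I_mult_left a)
  show "\<not> invertible_elt (1 + t' *\<^sub>R (st (cubic_step \<alpha> a) * cubic_step \<alpha> a))"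
  proof
    assume "invertible_elt (1 + t' *\<^sub>R (st (cubic_step \<alpha> a) * cubic_step \<alpha> a))"
    then have "invertible_elt (1 - sc (of_real (- t')) (st (cubic_step \<alpha> a) * cubic_step \<alpha> a))"
      by (simp only: sc_of_real[OF cI]) simp
    moreover have "complex_of_real (- t) ^ 3
        = of_real (- t') / of_real (\<alpha>\<^sup>2) * (of_real (\<alpha> + 1) * of_real (- t) - 1)\<^sup>2"
    proof -
      have "(- t) ^ 3 = - t' / \<alpha>\<^sup>2 * ((\<alpha> + 1) * (- t) - 1)\<^sup>2"
      proof -
        have "(\<alpha> + 1) * (- t) - 1 = - d" by (simp add: d_def)
        then show ?thesis using \<alpha> d by (simp add: t'_def)
      qed
      then have "complex_of_real ((- t) ^ 3) = of_real (- t' / \<alpha>\<^sup>2 * ((\<alpha> + 1) * (- t) - 1)\<^sup>2)"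
        by (simp only:)
      then show ?thesis by simp
    qed
    ultimately have "invertible_elt (1 - sc (of_real (- t)) (st a * a))"
      using invertible_of_cubic_step[OF a \<alpha>] by blast
    then show False using ninv by (simp only: sc_of_real[OF aI]) simp
  qed
qed

text \<open>The invariant P is left open because the descent is run twice: with the full bound
  \<open>radius_le_one\<close>, and in Hermitian algebras with a bound on positive spectral points
  only. s < e places the negative point -1/s below -1/e.\<close>

lemma cubic_step_iterate:
  assumes \<alpha>: "\<alpha> > 0" and P: "\<And>a. a \<in> I \<Longrightarrow> P a \<Longrightarrow> P (cubic_step \<alpha> a)"
    and a: "a \<in> I" "P a" and t: "t > 0" "\<not> invertible_elt (1 + t *\<^sub>R (st a * a))"
    and e: "e > 0"
  obtains c s where "c \<in> I" "P c" "0 < s" "s < e" "\<not> invertible_elt (1 + s *\<^sub>R (st c * c))"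
proof -
  define q where "q = (\<alpha> / (\<alpha> + 1))\<^sup>2"
  have q: "0 \<le> q" "q < 1" using \<alpha> by (auto simp: q_def power_less_one_iff)
  have step: "\<exists>c s. c \<in> I \<and> P c \<and> 0 < s \<and> s \<le> q ^ n * t \<and> \<not> invertible_elt (1 + s *\<^sub>R (st c * c))" for n
  proof (induction n)
    case 0
    then show ?case using a t by (intro exI[of _ a] exI[of _ t]) simp
  next
    case (Suc n)
    then obtain c s where c: "c \<in> I" "P c" "0 < s" "s \<le> q ^ n * t"
      "\<not> invertible_elt (1 + s *\<^sub>R (st c * c))" by blast
    obtain s' where s': "0 < s'" "s' \<le> q * s"
      "\<not> invertible_elt (1 + s' *\<^sub>R (st (cubic_step \<alpha> c) * cubic_step \<alpha> c))"
      using cubic_step_negative[OF c(1) \<alpha> c(3,5)] unfolding q_def by blast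
    have "q * s \<le> q * (q ^ n * t)" using c(4) q by (intro mult_left_mono) auto
    then show ?case using s' c P cubic_step_in_I
      by (intro exI[of _ "cubic_step \<alpha> c"] exI[of _ s']) auto
  qed
  have "(\<lambda>n. q ^ n * t) \<longlonglongrightarrow> 0 * t"
    using q by (intro tendsto_intros LIMSEQ_realpow_zero) auto
  then have "\<forall>\<^sub>F n in sequentially. q ^ n * t < e"
    using e order_tendstoD(2)[of _ "0::real" sequentially e] by simp
  then obtain n where "q ^ n * t < e" by (auto simp: eventually_sequentially)
  then show ?thesis using step[of n] that by force
qed

lemma rescale_to_contraction:
  assumes a: "a \<in> I"
  obtains r where "r > 0" "radius_le_one (st (r *\<^sub>R a) * (r *\<^sub>R a))"
proof
  define b where "b = st a * a"
  define r where "r = sqrt (1 / (1 + norm b))"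
  have pos: "1 + norm b > 0" by (simp add: add_pos_nonneg)
  then show "r > 0" by (simp add: r_def)
  have bI: "b \<in> I" by (simp add: b_def I_mult_left a)
  have r2: "r\<^sup>2 = 1 / (1 + norm b)" using pos by (simp add: r_def)
  have "power_contracting (t *\<^sub>R r\<^sup>2 *\<^sub>R b)" if "0 \<le> t" "t < 1" for t
  proof -
    have "norm (t *\<^sub>R r\<^sup>2 *\<^sub>R b) = t * (norm b / (1 + norm b))"
      using that pos unfolding r2 by simp
    also have "\<dots> \<le> 1 * (norm b / (1 + norm b))" using that pos by (intro mult_right_mono) auto
    also have "\<dots> < 1" using pos by simp
    finally show ?thesis unfolding power_contracting_def by (intro exI[of _ 1]) simp
  qed
  then show "radius_le_one (st (r *\<^sub>R a) * (r *\<^sub>R a))"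
    unfolding st_mult_self_scaleR b_def[symmetric]
    using radius_le_one_iff_power_contracting[OF I_scaleR[OF bI]] by blast
qed

lemma radius_le_oneD:
  assumes "radius_le_one x" "x \<in> I" "\<bar>t\<bar> < 1"
  shows "invertible_elt (1 - t *\<^sub>R x)"
  using assms sc_of_real[of x t] unfolding radius_le_one_def by (metis norm_of_real)

text \<open>For non-real \<lambda> = 1/z, every complex number \<omega> is of the form s \<lambda> + t \<lambda>^2 with real s, t.\<close>

lemma hermitian_witness:
  assumes h: "h \<in> I" "st h = h" and z: "Im z \<noteq> 0" and ninv: "\<not> invertible_elt (1 - sc z h)"
    and \<omega>: "\<omega> \<noteq> 0"
  obtains k where "k \<in> I" "st k = k" "\<not> invertible_elt (1 - sc (1 / \<omega>\<^sup>2) (k * k))"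
proof -
  have z0: "z \<noteq> 0" and iz: "Im (1 / z) \<noteq> 0" using z by (auto simp: Im_complex_div_eq_0)
  \<comment> \<open>Dividing s l + t l^2 = \<omega> by l = 1/z gives s + t l = \<omega> z, a real
    linear system for s and t, solvable since Im l \<noteq> 0.\<close>
  define l m where "l = 1 / z" and "m = \<omega> * z"
  define t where "t = Im m / Im l"
  define s where "s = Re m - t * Re l"
  have "m = of_real s + of_real t * l"
    using iz by (simp add: complex_eq_iff s_def t_def l_def[symmetric])
  then have eq: "\<omega> * z = of_real s + of_real t * (1 / z)" by (simp only: l_def m_def)
  define k where "k = s *\<^sub>R h + t *\<^sub>R (h * h)"
  have k: "k \<in> I" "st k = k" using h by (simp_all add: k_def I_intros st_simps)
  \<comment> \<open>Parameter of the second linear factor of 1 - k/\<omega>, read off from the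
    linear coefficient; z y = -t/\<omega> then follows from the choice of s and t.\<close>
  define y where "y = of_real s / \<omega> - z"
  have fac: "(1 - sc z h) * (1 - sc y h) = 1 - sc (1 / \<omega>) k"
  proof -
    have "z + y = 1 / \<omega> * of_real s" by (simp add: y_def)
    moreover have "z * y = - (1 / \<omega> * of_real t)"
    proof -
      have "\<omega> * (z * y) = z * (of_real s - \<omega> * z)" using \<omega> by (simp add: y_def field_simps)
      also have "\<dots> = - of_real t" unfolding eq using z0 by (simp add: field_simps)
      finally have "\<omega> * (z * y) = \<omega> * (- (1 / \<omega> * of_real t))" using \<omega> by simp
      then show ?thesis using \<omega> by (simp only: mult_cancel_left) simp
    qed
    moreover have "sc (1 / \<omega>) k = sc (1 / \<omega> * of_real s) h + sc (1 / \<omega> * of_real t) (h * h)"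
      unfolding k_def using h
      by (simp only: sc_add_right I_scaleR I_mult_left sc_of_real[symmetric] sc_sc sc_in_I)
    ultimately show ?thesis unfolding quadratic_factor[OF h(1)]
      using h by (simp add: sc_minus_left I_mult_left)
  qed
  have comm: "(1 - sc z h) * (1 - sc y h) = (1 - sc y h) * (1 - sc z h)"
    using h by (simp add: algebra_simps sc_mult_sc)
  have "\<not> invertible_elt (1 - sc (1 / \<omega>\<^sup>2) (k * k))"
  proof
    assume "invertible_elt (1 - sc (1 / \<omega>\<^sup>2) (k * k))"
    also have "1 - sc (1 / \<omega>\<^sup>2) (k * k) = (1 - sc (1 / \<omega>) k) * (1 - sc (- (1 / \<omega>)) k)"
      unfolding quadratic_factor[OF k(1)]
      using k by (simp add: sc_minus_left I_mult_left power2_eq_square)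
    finally have "invertible_elt (1 - sc (1 / \<omega>) k)"
      by (rule invertible_elt_commuting_factor) (simp add: sc_minus_left k algebra_simps)
    then show False
      unfolding fac[symmetric] using comm invertible_elt_commuting_factor ninv by blast
  qed
  then show ?thesis using k that by blast
qed

text \<open>\<omega> = \<i> turns a non-real spectral point of a Hermitian element into the point -1
  of k^2, which is \<open>st k * k\<close>.\<close>

lemma hermitian_ideal_of_invertible:
  assumes "\<And>a. a \<in> I \<Longrightarrow> invertible_elt (1 + st a * a)"
  shows "hermitian_ideal I sc st"
proof (unfold_locales, rule ccontr)
  fix x z assume "x \<in> I" "st x = x" "Im z \<noteq> 0" "\<not> invertible_elt (1 - sc z x)"
  then obtain k where k: "k \<in> I" "st k = k" "\<not> invertible_elt (1 - sc (1 / \<i>\<^sup>2) (k * k))"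
    using hermitian_witness[of x z \<i>] by auto
  then show False using assms[OF k(1)] by (simp add: sc_minus_left I_mult_left)
qed

text \<open>With \<omega>^2 = -\<i>, the element k^2, which is \<open>st k * k\<close>, acquires the
  non-real spectral point -\<i>.\<close>

lemma hermitian_ideal_of_real_star_spectrum:
  assumes "\<And>a z. a \<in> I \<Longrightarrow> Im z \<noteq> 0 \<Longrightarrow> invertible_elt (1 - sc z (st a * a))"
  shows "hermitian_ideal I sc st"
proof (unfold_locales, rule ccontr)
  fix x z assume "x \<in> I" "st x = x" "Im z \<noteq> 0" "\<not> invertible_elt (1 - sc z x)"
  then obtain k where k: "k \<in> I" "st k = k"
    "\<not> invertible_elt (1 - sc (1 / (csqrt (- \<i>))\<^sup>2) (k * k))"
    using hermitian_witness[of x z "csqrt (- \<i>)"] by auto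
  then show False using assms[OF k(1), of \<i>] by simp
qed

text \<open>After rescaling, the descent keeps the spectral radius at most 1 while the negative
  point is driven below -1.\<close>

lemma hermitian_ideal_of_cubic_step:
  assumes \<alpha>: "\<alpha> > 0"
    and step: "\<And>a. a \<in> I \<Longrightarrow> radius_le_one (st a * a)
      \<Longrightarrow> radius_le_one (st (cubic_step \<alpha> a) * cubic_step \<alpha> a)"
  shows "hermitian_ideal I sc st"
proof (rule hermitian_ideal_of_invertible, rule ccontr)
  fix a assume a: "a \<in> I" and n: "\<not> invertible_elt (1 + st a * a)"
  obtain r where r: "r > 0" "radius_le_one (st (r *\<^sub>R a) * (r *\<^sub>R a))"
    using rescale_to_contraction[OF a] .
  have "\<not> invertible_elt (1 + (1 / r\<^sup>2) *\<^sub>R (st (r *\<^sub>R a) * (r *\<^sub>R a)))"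
    unfolding st_mult_self_scaleR using n r by simp
  then obtain c s where "c \<in> I" "radius_le_one (st c * c)" "0 < s" "s < 1"
    "\<not> invertible_elt (1 + s *\<^sub>R (st c * c))"
    using cubic_step_iterate[of \<alpha> "\<lambda>a. radius_le_one (st a * a)" "r *\<^sub>R a" "1 / r\<^sup>2" 1]
      \<alpha> step I_scaleR[OF a] r by auto
  then show False using radius_le_oneD[of "st c * c" "- s"] by (simp add: I_mult_left)
qed

end

section \<open>Positivity in a Hermitian algebra\<close>

context hermitian_ideal
begin

theorem Shirali_Ford:
  assumes a: "a \<in> I"
  shows "invertible_elt (1 + st a * a)"
proof (rule ccontr)
  assume n: "\<not> invertible_elt (1 + st a * a)"
  \<comment> \<open>P bounds the positive spectral points of \<open>st a * a\<close> by 1 and says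
    nothing about the negative ones.\<close>
  define P where "P a \<longleftrightarrow> (\<forall>t. 0 \<le> t \<and> t < 1 \<longrightarrow> invertible_elt (1 - t *\<^sub>R (st a * a)))" for a
  obtain r where r: "r > 0" "radius_le_one (st (r *\<^sub>R a) * (r *\<^sub>R a))"
    using rescale_to_contraction[OF a] .
  have P0: "P (r *\<^sub>R a)"
    unfolding P_def using radius_le_oneD[OF r(2)] I_mult_left[OF I_scaleR[OF a]] by auto
  have P: "P (cubic_step 2 c)" if c: "c \<in> I" and Pc: "P c" for c
    unfolding P_def
  proof (intro allI impI)
    fix t :: real assume t: "0 \<le> t \<and> t < 1"
    have "invertible_elt (1 - sc (of_real t) (st (cubic_step 2 c) * cubic_step 2 c))"
    proof (rule invertible_cubic_step[OF c])
      fix z :: complex assume z: "z ^ 3 = of_real t / of_real (2\<^sup>2) * (of_real (2 + 1) * z - 1)\<^sup>2"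
      show "invertible_elt (1 - sc z (st c * c))"
      proof (cases "Im z = 0")
        case True
        then obtain x where x: "z = of_real x" using complex_is_Real_iff Reals_cases by metis
        have "x < 1"
          using real_root_less_one[of 2 "of_real t" x] z t unfolding x by simp
        \<comment> \<open>p(y) has the sign of y or vanishes, so a positive value comes only from a
          positive point, where P applies.\<close>
        moreover have "0 \<le> x"
        proof -
          have "complex_of_real (x ^ 3) = of_real (t / 4 * (3 * x - 1)\<^sup>2)"
            using z unfolding x by simp
          then have "x ^ 3 = t / 4 * (3 * x - 1)\<^sup>2" by (simp only: of_real_eq_iff)
          then have "x ^ 3 \<ge> 0" using t mult_nonneg_nonneg[of "t / 4" "(3 * x - 1)\<^sup>2"] by (simp only:) simp
          then show ?thesis using zero_le_odd_power[of 3 x] by (simp add: odd_numeral)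
        qed
        ultimately show ?thesis
          using Pc c unfolding P_def x by (simp add: sc_of_real I_mult_left)
      next
        case False
        then show ?thesis using c by (intro herm) (auto simp: I_mult_left st_mult)
      qed
    qed simp
    then show "invertible_elt (1 - t *\<^sub>R (st (cubic_step 2 c) * cubic_step 2 c))"
      using c by (simp add: sc_of_real I_mult_left cubic_step_in_I)
  qed
  have "\<not> invertible_elt (1 + (1 / r\<^sup>2) *\<^sub>R (st (r *\<^sub>R a) * (r *\<^sub>R a)))"
    unfolding st_mult_self_scaleR using n r by simp
  then obtain c s where c: "c \<in> I" "P c" "0 < s" "s < 1/2"
    "\<not> invertible_elt (1 + s *\<^sub>R (st c * c))"
    using cubic_step_iterate[of 2 P "r *\<^sub>R a" "1 / r\<^sup>2" "1/2"] P P0 I_scaleR[OF a] r by auto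
  \<comment> \<open>Scaling by sqrt(s) moves the point -1/s to -1 and the bound 1 on positive points
    to s < 1/2.\<close>
  have s: "st (sqrt s *\<^sub>R c) * (sqrt s *\<^sub>R c) = s *\<^sub>R (st c * c)"
    unfolding st_mult_self_scaleR using c by simp
  have "invertible_elt (1 + st (sqrt s *\<^sub>R c) * (sqrt s *\<^sub>R c))"
  proof (rule invertible_one_plus_star_of_bounded)
    fix t :: real assume t: "0 \<le> t" "t \<le> 2"
    then have "t * s \<le> 2 * s" using c by (intro mult_right_mono) auto
    also have "2 * s < 1" using c by simp
    finally have "t * s < 1" .
    then show "invertible_elt (1 - t *\<^sub>R (st (sqrt s *\<^sub>R c) * (sqrt s *\<^sub>R c)))"
      unfolding s using c t by (simp add: P_def)
  qed (rule I_scaleR[OF c(1)])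
  then show False using c unfolding s by simp
qed

lemma invertible_one_plus_scaled_star:
  assumes a: "a \<in> I" and t: "t \<ge> 0"
  shows "invertible_elt (1 + t *\<^sub>R (st a * a))"
  using Shirali_Ford[OF I_scaleR[OF a, of "sqrt t"]] t unfolding st_mult_self_scaleR by simp

text \<open>Non-real z are settled by \<open>herm\<close>, negative z by positivity; for the
  remaining z \<open>real_root_less_one\<close> leads back to the hypothesis.\<close>

theorem radius_le_one_cubic_step:
  assumes a: "a \<in> I" and \<alpha>: "\<alpha> \<ge> 2" and r: "radius_le_one (st a * a)"
  shows "radius_le_one (st (cubic_step \<alpha> a) * cubic_step \<alpha> a)"
  unfolding radius_le_one_def
proof (intro allI impI invertible_cubic_step[OF a])
  fix w z assume w: "cmod w < 1"
    and z: "z ^ 3 = w / of_real (\<alpha>\<^sup>2) * (of_real (\<alpha> + 1) * z - 1)\<^sup>2"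
  show "invertible_elt (1 - sc z (st a * a))"
  proof (cases "Im z = 0")
    case True
    then obtain x where x: "z = of_real x" using complex_is_Real_iff Reals_cases by metis
    have "x < 1" using real_root_less_one[OF \<alpha> w] z unfolding x by blast
    then show ?thesis
    proof (cases "x \<ge> 0")
      case True
      then show ?thesis using r \<open>x < 1\<close> unfolding radius_le_one_def x by simp
    next
      case False
      then show ?thesis
        using invertible_one_plus_scaled_star[OF a, of "- x"] a
        unfolding x by (simp add: sc_of_real I_mult_left)
    qed
  next
    case False
    then show ?thesis using a by (intro herm) (auto simp: I_mult_left st_mult)
  qed
qed (use \<alpha> in simp)

end

section \<open>The real unitization and translation of the statement\<close>

text \<open>A unit is adjoined even if A already has one; this can affect only whether 0 is a
  spectral point.\<close>

datatype 'a real_unitization = Unitization (scalar_part: real) (algebra_part: 'a)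

lemma real_unitization_eq_iff:
  "x = y \<longleftrightarrow> scalar_part x = scalar_part y \<and> algebra_part x = algebra_part y"
  by (cases x; cases y) simp

instantiation real_unitization :: (real_vector) real_vector
begin

definition "0 = Unitization 0 0"
definition "x + y = Unitization (scalar_part x + scalar_part y) (algebra_part x + algebra_part y)"
definition "- x = Unitization (- scalar_part x) (- algebra_part x)"
definition "x - y = Unitization (scalar_part x - scalar_part y) (algebra_part x - algebra_part y)"
definition "r *\<^sub>R x = Unitization (r * scalar_part x) (r *\<^sub>R algebra_part x)"

instance
  by standard (simp_all add: zero_real_unitization_def plus_real_unitization_def
      uminus_real_unitization_def minus_real_unitization_def scaleR_real_unitization_def
      real_unitization_eq_iff algebra_simps)

end

instantiation real_unitization :: (real_normed_vector) real_normed_vector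
begin

definition "norm x = \<bar>scalar_part x\<bar> + norm (algebra_part x)"
definition "dist x (y :: 'a real_unitization) = norm (x - y)"
definition "sgn (x :: 'a real_unitization) = x /\<^sub>R norm x"
definition [code del]: "(uniformity :: ('a real_unitization \<times> 'a real_unitization) filter)
  = (INF e\<in>{0<..}. principal {(x, y). dist x y < e})"
definition [code del]: "open (U :: 'a real_unitization set)
  \<longleftrightarrow> (\<forall>x\<in>U. eventually (\<lambda>(x', y). x' = x \<longrightarrow> y \<in> U) uniformity)"

instance
proof
  fix x y :: "'a real_unitization" and r :: real
  show "norm (x + y) \<le> norm x + norm y"
    unfolding norm_real_unitization_def plus_real_unitization_def
    using abs_triangle_ineq[of "scalar_part x" "scalar_part y"]
      norm_triangle_ineq[of "algebra_part x" "algebra_part y"] by simp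
  show "norm (r *\<^sub>R x) = \<bar>r\<bar> * norm x"
    by (simp add: norm_real_unitization_def scaleR_real_unitization_def abs_mult distrib_left)
  show "norm x = 0 \<longleftrightarrow> x = 0"
    by (simp add: norm_real_unitization_def zero_real_unitization_def real_unitization_eq_iff
        add_nonneg_eq_0_iff)
qed (rule dist_real_unitization_def sgn_real_unitization_def uniformity_real_unitization_def
    open_real_unitization_def)+

end

instantiation real_unitization :: (real_normed_algebra) real_normed_algebra_1
begin

definition "1 = Unitization 1 0"
definition "x * y = Unitization (scalar_part x * scalar_part y)
  (scalar_part x *\<^sub>R algebra_part y + scalar_part y *\<^sub>R algebra_part x
    + algebra_part x * algebra_part y)"

lemmas real_unitization_simps =
  zero_real_unitization_def one_real_unitization_def plus_real_unitization_def
  uminus_real_unitization_def minus_real_unitization_def times_real_unitization_def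
  scaleR_real_unitization_def real_unitization_eq_iff

instance
proof
  fix x y :: "'a real_unitization"
  show "norm (x * y) \<le> norm x * norm y"
  proof -
    have "norm (scalar_part x *\<^sub>R algebra_part y + scalar_part y *\<^sub>R algebra_part x
        + algebra_part x * algebra_part y)
      \<le> \<bar>scalar_part x\<bar> * norm (algebra_part y) + \<bar>scalar_part y\<bar> * norm (algebra_part x)
        + norm (algebra_part x) * norm (algebra_part y)"
      by (intro norm_triangle_le add_mono norm_mult_ineq) simp_all
    then show ?thesis
      by (simp add: norm_real_unitization_def times_real_unitization_def abs_mult algebra_simps)
  qed
  show "norm (1 :: 'a real_unitization) = 1"
    by (simp add: norm_real_unitization_def one_real_unitization_def)
qed (simp_all add: real_unitization_simps algebra_simps)

end

instance real_unitization :: ("{real_normed_algebra, banach}") banach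
proof
  fix X :: "nat \<Rightarrow> 'a real_unitization" assume X: "Cauchy X"
  have le: "\<bar>scalar_part x\<bar> \<le> norm x" "norm (algebra_part x) \<le> norm x" for x :: "'a real_unitization"
    by (simp_all add: norm_real_unitization_def)
  have "Cauchy (\<lambda>n. scalar_part (X n))"
  proof (rule CauchyI)
    fix e :: real assume "e > 0"
    then obtain M where "\<forall>m\<ge>M. \<forall>n\<ge>M. norm (X m - X n) < e" using CauchyD[OF X] by blast
    moreover have "norm (scalar_part (X m) - scalar_part (X n)) \<le> norm (X m - X n)" for m n
      using le(1)[of "X m - X n"] by (simp add: minus_real_unitization_def)
    ultimately show "\<exists>M. \<forall>m\<ge>M. \<forall>n\<ge>M. norm (scalar_part (X m) - scalar_part (X n)) < e"
      by (meson order_le_less_trans)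
  qed
  moreover have "Cauchy (\<lambda>n. algebra_part (X n))"
  proof (rule CauchyI)
    fix e :: real assume "e > 0"
    then obtain M where "\<forall>m\<ge>M. \<forall>n\<ge>M. norm (X m - X n) < e" using CauchyD[OF X] by blast
    moreover have "norm (algebra_part (X m) - algebra_part (X n)) \<le> norm (X m - X n)" for m n
      using le(2)[of "X m - X n"] by (simp add: minus_real_unitization_def)
    ultimately show "\<exists>M. \<forall>m\<ge>M. \<forall>n\<ge>M. norm (algebra_part (X m) - algebra_part (X n)) < e"
      by (meson order_le_less_trans)
  qed
  ultimately obtain r a where "(\<lambda>n. scalar_part (X n)) \<longlonglongrightarrow> r" "(\<lambda>n. algebra_part (X n)) \<longlonglongrightarrow> a"
    using Cauchy_convergent convergent_def by metis
  then have "(\<lambda>n. \<bar>scalar_part (X n) - r\<bar> + norm (algebra_part (X n) - a)) \<longlonglongrightarrow> \<bar>r - r\<bar> + norm (a - a)"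
    by (intro tendsto_intros)
  then have "(\<lambda>n. norm (X n - Unitization r a)) \<longlonglongrightarrow> 0"
    by (simp add: norm_real_unitization_def minus_real_unitization_def)
  then have "X \<longlonglongrightarrow> Unitization r a" using LIM_zero_iff tendsto_norm_zero_iff by blast
  then show "convergent X" by (rule convergentI)
qed

section \<open>Spectra and spectral radii of A in terms of the unitization\<close>

locale banach_star =
  fixes cmul :: "complex \<Rightarrow> 'a::{banach, real_normed_algebra} \<Rightarrow> 'a" and star :: "'a \<Rightarrow> 'a"
  assumes A: "banach_star_algebra cmul star"
begin

lemma cmul_of_real: "cmul (complex_of_real r) x = r *\<^sub>R x"
  and cmul_add_right: "cmul z (x + y) = cmul z x + cmul z y"
  and cmul_add_left: "cmul (z + w) x = cmul z x + cmul w x"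
  and cmul_cmul: "cmul z (cmul w x) = cmul (z * w) x"
  and cmul_mult: "cmul z x * y = cmul z (x * y)"
  and mult_cmul: "x * cmul z y = cmul z (x * y)"
  and norm_cmul: "norm (cmul z x) = cmod z * norm x"
  and star_add: "star (x + y) = star x + star y"
  and star_cmul: "star (cmul z x) = cmul (cnj z) (star x)"
  and star_mult: "star (x * y) = star y * star x"
  and star_star: "star (star x) = x"
  using A unfolding banach_star_algebra_def by metis+

lemma cmul_one: "cmul 1 x = x"
  using cmul_of_real[of 1 x] by simp

lemma cmul_minus_left: "cmul (- z) x = - cmul z x"
  by (metis add.right_inverse cmul_add_left cmul_of_real eq_neg_iff_add_eq_0 of_real_0
      add.commute scaleR_zero_left)

lemma cmul_minus_right: "cmul z (- x) = - cmul z x"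
  using cmul_cmul[of z "- 1" x] cmul_cmul[of "- 1" z x] cmul_one
  by (simp add: cmul_minus_left)

lemma cmul_scaleR: "cmul z (r *\<^sub>R x) = r *\<^sub>R cmul z x"
  by (metis cmul_cmul cmul_of_real mult.commute)

lemma star_scaleR: "star (r *\<^sub>R x) = r *\<^sub>R star x"
  by (metis cmul_of_real complex_cnj_complex_of_real star_cmul)

definition ideal :: "'a real_unitization set" where
  "ideal = {x. scalar_part x = 0}"

definition scal :: "complex \<Rightarrow> 'a real_unitization \<Rightarrow> 'a real_unitization" where
  "scal z x = Unitization 0 (cmul z (algebra_part x))"

definition ustar :: "'a real_unitization \<Rightarrow> 'a real_unitization" where
  "ustar x = Unitization (scalar_part x) (star (algebra_part x))"

abbreviation emb :: "'a \<Rightarrow> 'a real_unitization" where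
  "emb \<equiv> Unitization 0"

sublocale star_ideal ideal scal ustar
  by unfold_locales
    (simp_all add: ideal_def scal_def ustar_def real_unitization_simps norm_real_unitization_def
      cmul_of_real cmul_add_right cmul_add_left cmul_cmul cmul_mult mult_cmul norm_cmul
      star_add star_cmul star_mult star_star cmul_scaleR star_scaleR)

lemma emb_simps:
  "emb a * emb b = emb (a * b)" "r *\<^sub>R emb a = emb (r *\<^sub>R a)" "emb a - emb b = emb (a - b)"
  "ustar (emb a) = emb (star a)" "scal z (emb a) = emb (cmul z a)" "norm (emb a) = norm a"
  by (simp_all add: real_unitization_simps ustar_def scal_def norm_real_unitization_def)

lemma emb_in_ideal: "emb a \<in> ideal"
  by (simp add: ideal_def)

lemma ideal_cases:
  assumes "x \<in> ideal"
  obtains a where "x = emb a"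
  using assms by (cases x) (auto simp: ideal_def)

text \<open>An inverse of \<open>1 + emb y\<close> has scalar part 1, and its algebra part is a
  quasi-inverse of y, a notion that mentions no unit.\<close>

lemma invertible_one_plus_emb:
  "invertible_elt (1 + emb y) \<longleftrightarrow> (\<exists>c. y + c + y * c = 0 \<and> y + c + c * y = 0)"
proof
  assume "invertible_elt (1 + emb y)"
  then obtain v where "(1 + emb y) * v = 1" "v * (1 + emb y) = 1"
    unfolding invertible_elt_def by blast
  then show "\<exists>c. y + c + y * c = 0 \<and> y + c + c * y = 0"
    by (intro exI[of _ "algebra_part v"]) (auto simp: real_unitization_simps algebra_simps)
next
  assume "\<exists>c. y + c + y * c = 0 \<and> y + c + c * y = 0"
  then obtain c where "y + c + y * c = 0" "y + c + c * y = 0" by blast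
  then show "invertible_elt (1 + emb y)"
    unfolding invertible_elt_def
    by (intro exI[of _ "Unitization 1 c"]) (auto simp: real_unitization_simps algebra_simps)
qed

text \<open>Both cases of the definition amount to a quasi-inverse c of y = x/l. If A has a unit u
  and v inverts l u + x, then c = l v - u; otherwise the inverse is (1/l) e + c/l.\<close>

lemma tilde_invertible_iff:
  assumes l: "l \<noteq> 0"
  shows "tilde_invertible cmul l x \<longleftrightarrow> invertible_elt (1 + emb (cmul (1 / l) x))"
proof -
  define y where "y = cmul (1 / l) x"
  have x: "x = cmul l y" using l by (simp add: y_def cmul_cmul cmul_one)
  show ?thesis
  proof (cases "has_unit TYPE('a)")
    case True
    define u where "u = (SOME u::'a. is_unit_of u)"
    have "is_unit_of u" 
      unfolding u_def by (rule someI_ex) (use True in \<open>simp add: has_unit_def\<close>)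
    then have u: "u * z = z" "z * u = z" for z by (auto simp: is_unit_of_def)
    have "tilde_invertible cmul l x \<longleftrightarrow> (\<exists>v. (cmul l u + x) * v = u \<and> v * (cmul l u + x) = u)"
      using True by (simp add: tilde_invertible_def u_def Let_def)
    also have "\<dots> \<longleftrightarrow> (\<exists>c. y + c + y * c = 0 \<and> y + c + c * y = 0)"
    proof safe
      fix v assume v: "(cmul l u + x) * v = u" "v * (cmul l u + x) = u"
      define c where "c = cmul l v - u"
      have w: "cmul l v = c + u" by (simp add: c_def)
      have "(u + y) * cmul l v = u" "cmul l v * (u + y) = u"
        using v unfolding x by (simp_all add: cmul_mult mult_cmul algebra_simps cmul_add_right u)
      then have "y + c + y * c = 0" "y + c + c * y = 0"
        unfolding w by (simp_all add: algebra_simps u)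
      then show "\<exists>c. y + c + y * c = 0 \<and> y + c + c * y = 0" by blast
    next
      fix c assume c: "y + c + y * c = 0" "y + c + c * y = 0"
      then have "(u + y) * (c + u) = u" "(c + u) * (u + y) = u" by (simp_all add: algebra_simps u)
      moreover have "cmul l u + x = cmul l (u + y)" by (simp add: x cmul_add_right)
      ultimately have "(cmul l u + x) * cmul (1 / l) (c + u) = u"
        "cmul (1 / l) (c + u) * (cmul l u + x) = u"
        using l by (simp_all add: cmul_mult mult_cmul cmul_cmul cmul_one)
      then show "\<exists>v. (cmul l u + x) * v = u \<and> v * (cmul l u + x) = u" by blast
    qed
    finally show ?thesis unfolding invertible_one_plus_emb y_def .
  next
    case False
    then have "tilde_invertible cmul l x \<longleftrightarrow> (\<exists>m b. l * m = 1 \<and> cmul l b + cmul m x + x * b = 0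
        \<and> cmul m x + cmul l b + b * x = 0)"
      by (simp add: tilde_invertible_def)
    also have "\<dots> \<longleftrightarrow> (\<exists>c. y + c + y * c = 0 \<and> y + c + c * y = 0)"
    proof safe
      fix m b assume "l * m = 1" and b: "cmul l b + cmul m x + x * b = 0"
        "cmul m x + cmul l b + b * x = 0"
      then have "m = 1 / l" using l by (simp add: field_simps)
      then have "cmul m x = y" by (simp add: y_def)
      moreover have "x * b = y * cmul l b" "b * x = cmul l b * y"
        by (simp_all add: x cmul_mult mult_cmul)
      ultimately have "y + cmul l b + y * cmul l b = 0" "y + cmul l b + cmul l b * y = 0"
        using b by (simp_all add: add.commute)
      then show "\<exists>c. y + c + y * c = 0 \<and> y + c + c * y = 0" by blast
    next
      fix c assume c: "y + c + y * c = 0" "y + c + c * y = 0"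
      define b where "b = cmul (1 / l) c"
      have "cmul l b = c" "x * b = y * c" "b * x = c * y" "cmul (1 / l) x = y"
        using l by (simp_all add: b_def x cmul_cmul cmul_one cmul_mult mult_cmul)
      then have "l * (1 / l) = 1 \<and> cmul l b + cmul (1 / l) x + x * b = 0
          \<and> cmul (1 / l) x + cmul l b + b * x = 0"
        using l c by (simp add: add.commute)
      then show "\<exists>m b. l * m = 1 \<and> cmul l b + cmul m x + x * b = 0
          \<and> cmul m x + cmul l b + b * x = 0" by blast
    qed
    finally show ?thesis unfolding invertible_one_plus_emb y_def .
  qed
qed

lemma spec_iff:
  assumes "l \<noteq> 0"
  shows "l \<in> spec cmul a \<longleftrightarrow> \<not> invertible_elt (1 - scal (1 / l) (emb a))"
proof -
  have "1 + emb (cmul (1 / l) (- a)) = 1 - scal (1 / l) (emb a)"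
    by (simp add: real_unitization_simps scal_def cmul_minus_right)
  then show ?thesis unfolding spec_def using tilde_invertible_iff[OF assms, of "- a"] by simp
qed

lemma cmod_spec_le:
  assumes "l \<in> spec cmul a"
  shows "cmod l \<le> norm a"
proof (rule ccontr)
  assume n: "\<not> cmod l \<le> norm a"
  then have l: "cmod l > norm a" "cmod l > 0" "l \<noteq> 0"
    using norm_ge_zero[of a] by (auto simp: not_le intro: le_less_trans)
  have "norm (scal (1 / l) (emb a)) < 1"
    using l by (simp add: norm_sc emb_in_ideal emb_simps(6) norm_divide)
  then have "power_contracting (scal (1 / l) (emb a))"
    unfolding power_contracting_def by (intro exI[of _ 1]) simp
  then show False using assms power_contracting_invertible spec_iff[OF l(3)] by blast
qed

lemma emb_npow: "emb (npow a n) = emb a ^ Suc n"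
proof (induction n)
  case (Suc n)
  have "emb (npow a (Suc n)) = emb a * emb (npow a n)" by (simp add: emb_simps)
  also have "\<dots> = emb a ^ Suc (Suc n)" unfolding Suc by simp
  finally show ?case .
qed simp

lemma norm_npow_scaleR: "norm ((t *\<^sub>R emb a) ^ Suc n) = \<bar>t\<bar> ^ Suc n * norm (npow a n)"
  by (simp only: scaleR_power norm_scaleR power_abs emb_npow[symmetric] emb_simps(6))

text \<open>t times the n-th root term is below 1 iff the power of \<open>t *\<^sub>R emb a\<close>
  with exponent n + 1 has norm below 1. Quantifying over t < 1 handles an infimum that is not
  attained.\<close>

lemma r_lambda_le_one_iff: "r_lambda a \<le> 1 \<longleftrightarrow> radius_le_one (emb a)"
proof -
  define f where "f n = root (Suc n) (norm (npow a n))" for n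
  have f0: "0 \<le> f n" for n by (simp add: f_def)
  have bdd: "bdd_below (range f)" by (rule bdd_belowI[of _ 0]) (use f0 in auto)
  have key: "norm ((t *\<^sub>R emb a) ^ Suc n) < 1 \<longleftrightarrow> t * f n < 1" if t: "0 \<le> t" for t n
  proof -
    have "t * f n = root (Suc n) (norm ((t *\<^sub>R emb a) ^ Suc n))"
      unfolding norm_npow_scaleR real_root_mult f_def using t
      by (simp only: abs_of_nonneg real_root_power_cancel[OF zero_less_Suc t])
    then show ?thesis by (simp add: real_root_lt_1_iff)
  qed
  have pc: "power_contracting (t *\<^sub>R emb a) \<longleftrightarrow> (\<exists>n. t * f n < 1)" if t: "0 \<le> t" for t
  proof -
    have "(\<exists>n>0. Q n) \<longleftrightarrow> (\<exists>n. Q (Suc n))" for Q by (metis gr0_conv_Suc)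
    then show ?thesis unfolding power_contracting_def key[OF t, symmetric] .
  qed
  have "r_lambda a \<le> 1 \<longleftrightarrow> (\<forall>t. 0 \<le> t \<and> t < 1 \<longrightarrow> (\<exists>n. t * f n < 1))"
  proof safe
    fix t :: real assume r: "r_lambda a \<le> 1" and t: "0 \<le> t" "t < 1"
    show "\<exists>n. t * f n < 1"
    proof (cases "t = 0")
      case False
      have "t * r_lambda a \<le> t * 1" using r t by (intro mult_left_mono) auto
      then have "t * r_lambda a < 1" using t by simp
      then have "r_lambda a < 1 / t" using t False by (simp add: field_simps)
      then have "(INF n. f n) < 1 / t" by (simp add: r_lambda_def f_def)
      then obtain n where "f n < 1 / t" using cINF_less_iff[OF _ bdd] by auto
      then show ?thesis using t False by (auto simp: field_simps)
    qed simp
  next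
    assume *: "\<forall>t. 0 \<le> t \<and> t < 1 \<longrightarrow> (\<exists>n. t * f n < 1)"
    show "r_lambda a \<le> 1"
    proof (rule ccontr)
      assume "\<not> r_lambda a \<le> 1"
      then have R: "r_lambda a > 1" by simp
      then obtain n where "1 / r_lambda a * f n < 1" using *[rule_format, of "1 / r_lambda a"] by auto
      then have "f n < r_lambda a" using R by (simp add: field_simps)
      moreover have "r_lambda a \<le> f n"
        unfolding r_lambda_def f_def[symmetric] by (rule cINF_lower[OF bdd]) simp
      ultimately show False by simp
    qed
  qed
  also have "\<dots> \<longleftrightarrow> radius_le_one (emb a)"
    unfolding radius_le_one_iff_power_contracting[OF emb_in_ideal] using pc by auto
  finally show ?thesis .
qed

lemma r_sigma_le_one_iff: "r_sigma star a \<le> 1 \<longleftrightarrow> radius_le_one (ustar (emb a) * emb a)"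
  by (simp add: r_sigma_def r_lambda_le_one_iff emb_simps)

lemma emb_cubic_step:
  "cubic_step \<alpha> (emb a) = emb (inverse \<alpha> *\<^sub>R ((\<alpha> + 1) *\<^sub>R a - a * star a * a))"
  by (simp only: cubic_step_def emb_simps)

text \<open>The point 0, which \<open>spec_iff\<close> does not reach, is real anyway.\<close>

lemma hermitian_iff: "hermitian cmul star \<longleftrightarrow> hermitian_ideal ideal scal ustar"
proof
  assume h: "hermitian cmul star"
  show "hermitian_ideal ideal scal ustar"
  proof unfold_locales
    fix x z assume x: "x \<in> ideal" "ustar x = x" and z: "Im z \<noteq> 0"
    obtain a where a: "x = emb a" using ideal_cases[OF x(1)] .
    then have "star a = a" using x(2) by (simp add: emb_simps)
    moreover have "1 / z \<notin> \<real>" using z by (auto simp: complex_is_Real_iff Im_complex_div_eq_0)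
    ultimately have "1 / z \<notin> spec cmul a" using h unfolding hermitian_def by blast
    moreover have "1 / z \<noteq> 0" using z by auto
    ultimately show "invertible_elt (1 - scal z x)" using spec_iff[of "1 / z" a] by (simp add: a)
  qed
next
  assume "hermitian_ideal ideal scal ustar"
  then interpret hermitian_ideal ideal scal ustar .
  show "hermitian cmul star" unfolding hermitian_def
  proof (intro allI impI subsetI, rule ccontr)
    fix a l assume a: "star a = a" and l: "l \<in> spec cmul a" "l \<notin> \<real>"
    then have "Im (1 / l) \<noteq> 0" "l \<noteq> 0" by (auto simp: complex_is_Real_iff Im_complex_div_eq_0)
    moreover have "ustar (emb a) = emb a" by (simp add: emb_simps a)
    ultimately show False using herm[OF emb_in_ideal] spec_iff l(1) by blast
  qed
qed

section \<open>Each condition compared with being Hermitian\<close>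

lemma spec_star_of_hermitian:
  assumes h: "hermitian cmul star" and l: "l \<in> spec cmul (star a * a)"
  shows "l \<in> \<real>" "Re l \<ge> 0"
proof -
  have "star (star a * a) = star a * a" by (simp add: star_mult star_star)
  then show real: "l \<in> \<real>" using h l unfolding hermitian_def by blast
  interpret hermitian_ideal ideal scal ustar using h hermitian_iff by blast
  show "Re l \<ge> 0"
  proof (rule ccontr)
    assume n: "\<not> Re l \<ge> 0"
    obtain r where r: "l = of_real r" using real Reals_cases by blast
    then have "r < 0" using n by simp
    then have "invertible_elt (1 + (- (1 / r)) *\<^sub>R (ustar (emb a) * emb a))"
      by (intro invertible_one_plus_scaled_star emb_in_ideal) simp
    also have "1 + (- (1 / r)) *\<^sub>R (ustar (emb a) * emb a) = 1 - scal (1 / l) (emb (star a * a))"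
      using sc_of_real[OF emb_in_ideal, of "1 / r" "star a * a"] by (simp add: r emb_simps(1,4))
    finally show False using l spec_iff[of l] \<open>r < 0\<close> r by auto
  qed
qed

lemma hermitian_of_tilde_invertible:
  assumes "\<And>a. tilde_invertible cmul 1 (star a * a)"
  shows "hermitian cmul star"
  unfolding hermitian_iff
proof (rule hermitian_ideal_of_invertible)
  fix x assume "x \<in> ideal"
  then obtain a where "x = emb a" by (rule ideal_cases)
  then show "invertible_elt (1 + ustar x * x)"
    using assms[of a] tilde_invertible_iff[of 1] by (simp add: emb_simps cmul_one)
qed

lemma tilde_invertible_one_iff: "tilde_invertible cmul 1 x \<longleftrightarrow> -1 \<notin> spec cmul x"
  using tilde_invertible_iff[of 1 x] spec_iff[of "-1" x]
  by (simp add: emb_simps cmul_one cmul_minus_left real_unitization_simps)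

text \<open>In a Hermitian algebra these spectra lie in [0, oo) and are bounded by the norm, without
  which \<open>Sup\<close> would carry no information. Conversely, realness of the spectra of all
  \<open>star a * a\<close> makes A Hermitian.\<close>

lemma hermitian_iff_bounded:
  "hermitian cmul star \<longleftrightarrow> (\<forall>a. let S = spec cmul (star a * a);
      lam = Sup ({Re z | z. z \<in> S \<and> z \<in> \<real> \<and> Re z \<ge> 0} \<union> {0})
    in S \<subseteq> {z. z \<in> \<real> \<and> - lam \<le> Re z \<and> Re z \<le> lam})" (is "_ = ?R")
proof
  assume h: "hermitian cmul star"
  show ?R unfolding Let_def
  proof (intro allI subsetI CollectI)
    fix a z assume z: "z \<in> spec cmul (star a * a)"
    define T where "T = {Re z | z. z \<in> spec cmul (star a * a) \<and> z \<in> \<real> \<and> Re z \<ge> 0} \<union> {0}"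
    have "bdd_above T"
    proof (rule bdd_aboveI)
      fix y assume "y \<in> T"
      then consider "y = 0" | w where "y = Re w" "w \<in> spec cmul (star a * a)"
        unfolding T_def by blast
      then show "y \<le> norm (star a * a)"
        by cases (auto intro: order_trans[OF complex_Re_le_cmod cmod_spec_le])
    qed
    then have "0 \<le> Sup T" "Re z \<le> Sup T"
      using spec_star_of_hermitian[OF h z] z by (auto simp: T_def intro!: cSup_upper)
    then show "z \<in> \<real> \<and> - Sup ({Re z | z. z \<in> spec cmul (star a * a) \<and> z \<in> \<real> \<and> Re z \<ge> 0} \<union> {0}) \<le> Re z
      \<and> Re z \<le> Sup ({Re z | z. z \<in> spec cmul (star a * a) \<and> z \<in> \<real> \<and> Re z \<ge> 0} \<union> {0})"
      using spec_star_of_hermitian[OF h z] unfolding T_def by simp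
  qed
next
  assume R: ?R
  have "hermitian_ideal ideal scal ustar"
  proof (rule hermitian_ideal_of_real_star_spectrum)
    fix x z assume x: "x \<in> ideal" and z: "Im z \<noteq> 0"
    obtain a where a: "x = emb a" using ideal_cases[OF x] .
    have "1 / z \<notin> \<real>" "1 / z \<noteq> 0" using z by (auto simp: complex_is_Real_iff Im_complex_div_eq_0)
    then have "1 / z \<notin> spec cmul (star a * a)" using R unfolding Let_def by blast
    then show "invertible_elt (1 - scal z (ustar x * x))"
      using spec_iff[OF \<open>1 / z \<noteq> 0\<close>, of "star a * a"] by (simp add: a emb_simps)
  qed
  then show "hermitian cmul star" by (simp add: hermitian_iff)
qed

lemma hermitian_iff_cubic_step:
  assumes \<alpha>: "\<alpha> \<ge> 2"
  shows "hermitian cmul star \<longleftrightarrow> (\<forall>a. r_sigma star a \<le> 1 \<longrightarrow>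
    r_sigma star (inverse \<alpha> *\<^sub>R ((\<alpha> + 1) *\<^sub>R a - a * star a * a)) \<le> 1)"
  unfolding r_sigma_le_one_iff emb_cubic_step[symmetric]
proof
  assume "hermitian cmul star"
  then interpret hermitian_ideal ideal scal ustar by (simp add: hermitian_iff)
  show "\<forall>a. radius_le_one (ustar (emb a) * emb a) \<longrightarrow>
      radius_le_one (ustar (cubic_step \<alpha> (emb a)) * cubic_step \<alpha> (emb a))"
    using radius_le_one_cubic_step[OF emb_in_ideal \<alpha>] by blast
next
  assume *: "\<forall>a. radius_le_one (ustar (emb a) * emb a) \<longrightarrow>
      radius_le_one (ustar (cubic_step \<alpha> (emb a)) * cubic_step \<alpha> (emb a))"
  have "hermitian_ideal ideal scal ustar"
    by (rule hermitian_ideal_of_cubic_step[of \<alpha>]) (use \<alpha> * in \<open>auto elim!: ideal_cases\<close>)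
  then show "hermitian cmul star" by (simp add: hermitian_iff)
qed

lemma hermitian_iff_tilde_invertible:
  "hermitian cmul star \<longleftrightarrow> (\<forall>a. tilde_invertible cmul 1 (star a * a))"
proof
  assume h: "hermitian cmul star"
  show "\<forall>a. tilde_invertible cmul 1 (star a * a)"
    unfolding tilde_invertible_one_iff using spec_star_of_hermitian(2)[OF h, of "-1"] by auto
qed (blast intro: hermitian_of_tilde_invertible)

lemma hermitian_iff_no_negative_spectrum:
  "hermitian cmul star \<longleftrightarrow> (\<forall>a. \<forall>l::real. l < 0 \<longrightarrow> complex_of_real l \<notin> spec cmul (star a * a))"
    (is "_ = ?R")
proof
  assume h: "hermitian cmul star"
  show ?R using spec_star_of_hermitian(2)[OF h] by fastforce
next
  assume R: ?R
  show "hermitian cmul star"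
    unfolding hermitian_iff_tilde_invertible tilde_invertible_one_iff
    using R[rule_format, of "-1"] by simp
qed

end

theorem theorem17p12:
  fixes cmul :: "complex \<Rightarrow> 'a::{banach, real_normed_algebra} \<Rightarrow> 'a"
    and star :: "'a \<Rightarrow> 'a"
    and \<alpha> :: real
  assumes A: "banach_star_algebra cmul star"
    and alpha: "\<alpha> \<ge> 2"
  defines "\<beta> \<equiv> \<alpha> + 1"
  shows
   "(hermitian cmul star
      \<longleftrightarrow> (\<forall>a. let S = spec cmul (star a * a);
                  lam = Sup ({Re z | z. z \<in> S \<and> z \<in> \<real> \<and> Re z \<ge> 0} \<union> {0})
              in S \<subseteq> {z. z \<in> \<real> \<and> - lam \<le> Re z \<and> Re z \<le> lam}))
    \<and> (hermitian cmul star
      \<longleftrightarrow> (\<forall>a. r_sigma star a \<le> 1 \<longrightarrow>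
             r_sigma star (scaleR (inverse \<alpha>) (scaleR \<beta> a - a * star a * a)) \<le> 1))
    \<and> (hermitian cmul star
      \<longleftrightarrow> (\<forall>a. \<forall>l::real. l < 0 \<longrightarrow> complex_of_real l \<notin> spec cmul (star a * a)))
    \<and> (hermitian cmul star
      \<longleftrightarrow> (\<forall>a. tilde_invertible cmul 1 (star a * a)))"
proof -
  interpret banach_star cmul star by (unfold_locales) (rule A)
  show ?thesis
    unfolding \<beta>_def
    by (intro conjI hermitian_iff_bounded hermitian_iff_cubic_step alpha
        hermitian_iff_no_negative_spectrum hermitian_iff_tilde_invertible)
qed

end
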